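(* Let $k$ be an uncountable field of characteristic $0$, and let $R=R(k,1)$ be the ring constructed in the context. Then $R$ is a principal ideal domain, but $R$ is not a Euclidean domain.
   Context: Construction of $R(k,1)$: let $k$ be a field of characteristic $0$. Fix a sequence of prime numbers $(p_i)_{i\geq 1}$ such that $\mathbb{Q}=\bigcup_i \frac{1}{p_1\cdots p_i}\mathbb{Z}$. Let $\alpha_i$ ($i\geq 1$) be indeterminates over $k$, $K=k(\alpha_i:i\geq 1)$, and for $i\geq 1$ let $R_i=K[t_i,t_i^{-1}]$ be the Laurent polynomial ring in one variable over $K$. Let $\phi_i:R_i\to R_{i+1}$ be the $K$-algebra homomorphism with $\phi_i(t_i)=\alpha_{i+1}^{-1}t_{i+1}^{p_i}$. Set $R(k,1)=\varinjlim_i R_i$ along the maps $\phi_i$. (This ring is $\mathbb{Q}$-graded, with $K$ in degree $0$ and $\deg t_i=\frac{1}{p_1\cdots p_{i-1}}$.) *)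

theory Defs
  imports
    "HOL-Library.Poly_Mapping"
    "HOL-Library.Countable_Set"
    "HOL-Computational_Algebra.Fraction_Field"
    "HOL-Computational_Algebra.Primes"
    "HOL-Algebra.Ring_Divisibility"
begin

hide_const (open) Divisibility.prime

text \<open>All sequences start at index 0, whereas the usual presentation starts at 1: the indeterminate
  \<open>\<alpha>\<^sub>i\<close>, the prime \<open>p\<^sub>i\<close> and the ring \<open>R\<^sub>i\<close> are called \<open>\<alpha>\<^sub>i\<^sub>+\<^sub>1\<close>, \<open>p\<^sub>i\<^sub>+\<^sub>1\<close>, \<open>R\<^sub>i\<^sub>+\<^sub>1\<close> there. The formula
  \<open>t\<^sub>i \<mapsto> \<alpha>\<^sub>i\<^sub>+\<^sub>1\<^sup>-\<^sup>1 t\<^sub>i\<^sub>+\<^sub>1^(p\<^sub>i)\<close> is invariant under this shift.\<close>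

text \<open>\<open>K = k(\<alpha>\<^sub>i : i)\<close>: monomials are finitely supported exponent functions, polynomials are
  finitely supported functions on monomials.\<close>

type_synonym 'k ratfun = "((nat \<Rightarrow>\<^sub>0 nat) \<Rightarrow>\<^sub>0 'k) fract"

definition alpha :: "nat \<Rightarrow> 'k::idom ratfun" where
  "alpha i = Fract (Poly_Mapping.single (Poly_Mapping.single i 1) 1) 1"

text \<open>Each \<open>R\<^sub>i\<close> is a copy of \<open>K[t, t\<^sup>-\<^sup>1]\<close>, the group algebra of the integers over \<open>K\<close>;
  the Laurent monomial \<open>c t\<^sup>n\<close> is \<open>Poly_Mapping.single n c\<close>.\<close>

type_synonym 'k laurent = "int \<Rightarrow>\<^sub>0 'k ratfun"

definition phi :: "(nat \<Rightarrow> nat) \<Rightarrow> nat \<Rightarrow> 'k::idom laurent \<Rightarrow> 'k laurent" where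
  "phi p i f = (\<Sum>n\<in>Poly_Mapping.keys f.
     Poly_Mapping.single (int (p i) * n)
       (Poly_Mapping.lookup f n * inverse (alpha (Suc i)) powi n))"

lemma alpha_nonzero: "alpha i \<noteq> (0 :: 'k::idom ratfun)"
proof -
  have "Poly_Mapping.single (Poly_Mapping.single i (1::nat)) (1::'k) \<noteq> 0"
    by (metis lookup_single_eq lookup_zero one_neq_zero)
  then show ?thesis
    by (simp add: alpha_def Zero_fract_def eq_fract)
qed

lemma phi_single:
  "phi p i (Poly_Mapping.single n c) =
     Poly_Mapping.single (int (p i) * n) (c * inverse (alpha (Suc i)) powi n)"
  by (cases "c = 0") (simp_all add: phi_def)

text \<open>\<open>phi p i\<close> is the \<open>K\<close>-algebra homomorphism determined by the image of \<open>t\<^sub>i\<close>.\<close>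

lemma phi_t: "phi p i (Poly_Mapping.single 1 1) =
    Poly_Mapping.single (int (p i)) (inverse (alpha (Suc i)))"
  by (simp add: phi_single)

lemma phi_const: "phi p i (Poly_Mapping.single 0 c) = Poly_Mapping.single 0 c"
  by (simp add: phi_single)

lemma phi_one: "phi p i 1 = 1"
  using phi_const[of p i 1] by simp

lemma phi_add: "phi p i (f + g) = phi p i f + phi p i g"
proof -
  let ?F = "\<lambda>f n. Poly_Mapping.single (int (p i) * n)
       (Poly_Mapping.lookup f n * inverse (alpha (Suc i)) powi n)"
  let ?S = "Poly_Mapping.keys f \<union> Poly_Mapping.keys g"
  have *: "phi p i h = (\<Sum>n\<in>?S. ?F h n)" if "Poly_Mapping.keys h \<subseteq> ?S" for h
    unfolding phi_def
    by (rule sum.mono_neutral_left) (use that in \<open>auto simp: in_keys_iff\<close>)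
  have "phi p i (f + g) = (\<Sum>n\<in>?S. ?F (f + g) n)"
    by (rule *) (rule Poly_Mapping.keys_add)
  also have "\<dots> = (\<Sum>n\<in>?S. ?F f n) + (\<Sum>n\<in>?S. ?F g n)"
    by (simp add: lookup_add single_add distrib_right sum.distrib)
  also have "\<dots> = phi p i f + phi p i g"
    by (simp add: *)
  finally show ?thesis .
qed

lemma phi_zero: "phi p i 0 = 0"
  by (simp add: phi_def)

lemma phi_mult:
  fixes f g :: "'k::idom laurent"
  shows "phi p i (f * g) = phi p i f * phi p i g"
proof -
  have sums: "phi p i (sum h A) = (\<Sum>x\<in>A. phi p i (h x))"
    for h :: "int \<Rightarrow> 'k laurent" and A
    by (induction A rule: infinite_finite_induct) (auto simp: phi_add phi_zero)
  define mon where "mon h n = Poly_Mapping.single n (Poly_Mapping.lookup h n)"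
    for h :: "'k laurent" and n
  have repr: "h = (\<Sum>n\<in>Poly_Mapping.keys h. mon h n)" for h :: "'k laurent"
    by (rule poly_mapping_eqI)
       (auto simp: mon_def lookup_sum lookup_single when_def in_keys_iff)
  have mon: "phi p i (mon f m * mon g n) = phi p i (mon f m) * phi p i (mon g n)" for m n
    by (simp add: mon_def mult_single phi_single alpha_nonzero power_int_add algebra_simps)
  have "phi p i (f * g) = phi p i ((\<Sum>m\<in>Poly_Mapping.keys f. mon f m) *
      (\<Sum>n\<in>Poly_Mapping.keys g. mon g n))"
    using repr[of f] repr[of g] by simp
  also have "\<dots> = phi p i (\<Sum>m\<in>Poly_Mapping.keys f. mon f m) *
      phi p i (\<Sum>n\<in>Poly_Mapping.keys g. mon g n)"
    by (simp add: sum_product sums mon)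
  also have "\<dots> = phi p i f * phi p i g"
    using repr[of f] repr[of g] by simp
  finally show ?thesis .
qed

text \<open>The direct limit of \<open>R\<^sub>0 \<rightarrow> R\<^sub>1 \<rightarrow> \<dots>\<close>, where all \<open>R\<^sub>i\<close> have the same underlying type and
  \<open>f i\<close> is the map from \<open>R\<^sub>i\<close> to \<open>R\<^sub>i\<^sub>+\<^sub>1\<close>: the disjoint union of the \<open>R\<^sub>i\<close>, with elements identified
  when their images agree at some later stage.\<close>

definition transition :: "(nat \<Rightarrow> 'r \<Rightarrow> 'r) \<Rightarrow> nat \<Rightarrow> nat \<Rightarrow> 'r \<Rightarrow> 'r" where
  "transition f i j = fold f [i..<j]"

definition dirlim_rel :: "(nat \<Rightarrow> 'r \<Rightarrow> 'r) \<Rightarrow> ((nat \<times> 'r) \<times> (nat \<times> 'r)) set" where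
  "dirlim_rel f =
     {((i, a), (j, b)). \<exists>n. i \<le> n \<and> j \<le> n \<and> transition f i n a = transition f j n b}"

definition dirlim_class :: "(nat \<Rightarrow> 'r \<Rightarrow> 'r) \<Rightarrow> nat \<Rightarrow> 'r \<Rightarrow> (nat \<times> 'r) set" where
  "dirlim_class f i a = dirlim_rel f `` {(i, a)}"

definition dirlim_op ::
  "(nat \<Rightarrow> 'r \<Rightarrow> 'r) \<Rightarrow> ('r \<Rightarrow> 'r \<Rightarrow> 'r) \<Rightarrow>
    (nat \<times> 'r) set \<Rightarrow> (nat \<times> 'r) set \<Rightarrow> (nat \<times> 'r) set" where
  "dirlim_op f oper X Y =
     (\<Union>(i, a)\<in>X. \<Union>(j, b)\<in>Y.
        dirlim_class f (max i j)
          (oper (transition f i (max i j) a) (transition f j (max i j) b)))"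

definition dirlim :: "(nat \<Rightarrow> 'r::comm_ring_1 \<Rightarrow> 'r) \<Rightarrow> (nat \<times> 'r) set ring" where
  "dirlim f = \<lparr>carrier = UNIV // dirlim_rel f,
     mult = dirlim_op f (*), one = dirlim_class f 0 1,
     zero = dirlim_class f 0 0, add = dirlim_op f (+)\<rparr>"

definition Rk1 :: "(nat \<Rightarrow> nat) \<Rightarrow> (nat \<times> 'k::idom laurent) set ring" where
  "Rk1 p = dirlim (phi p)"

text \<open>The unions and quotients above are well defined as soon as the maps are compatible with the
  operations.\<close>

lemma transition_refl: "transition f i i = id"
  by (simp add: transition_def)

lemma transition_Suc: "i \<le> j \<Longrightarrow> transition f i (Suc j) a = f j (transition f i j a)"
  by (simp add: transition_def)

lemma transition_trans:
  assumes "i \<le> j" "j \<le> n"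
  shows "transition f j n (transition f i j a) = transition f i n a"
  using assms(2)
  by (induction n rule: dec_induct) (use assms(1) in \<open>auto simp: transition_refl transition_Suc\<close>)

lemma equiv_dirlim_rel: "equiv UNIV (dirlim_rel f)"
proof (rule equivI)
  show "trans (dirlim_rel f)"
  proof (rule transI)
    fix x y z assume "(x, y) \<in> dirlim_rel f" "(y, z) \<in> dirlim_rel f"
    then obtain i a j b l c m n where
      xyz: "x = (i, a)" "y = (j, b)" "z = (l, c)" and
      mn: "i \<le> m" "j \<le> m" "transition f i m a = transition f j m b"
        "j \<le> n" "l \<le> n" "transition f j n b = transition f l n c"
      by (auto simp: dirlim_rel_def)
    have "transition f i (max m n) a = transition f m (max m n) (transition f i m a)"
      by (rule transition_trans[symmetric]) (use mn in auto)
    also have "\<dots> = transition f j (max m n) b"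
      unfolding mn(3) by (rule transition_trans) (use mn in auto)
    also have "\<dots> = transition f n (max m n) (transition f j n b)"
      by (rule transition_trans[symmetric]) (use mn in auto)
    also have "\<dots> = transition f l (max m n) c"
      unfolding mn(6) by (rule transition_trans) (use mn in auto)
    finally show "(x, z) \<in> dirlim_rel f"
      using mn xyz by (auto simp: dirlim_rel_def intro!: exI[of _ "max m n"])
  qed
qed (auto simp: refl_on_def dirlim_rel_def intro!: symI dest: sym)

lemma dirlim_op_class:
  assumes hom: "\<And>i a b. f i (oper a b) = oper (f i a) (f i b)"
  shows "dirlim_op f oper (dirlim_class f i a) (dirlim_class f j b) =
    dirlim_class f (max i j)
      (oper (transition f i (max i j) a) (transition f j (max i j) b))"
proof -
  have hom': "transition f i n (oper a b) = oper (transition f i n a) (transition f i n b)"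
    if "i \<le> n" for i n a b
    using that by (induction n rule: dec_induct)
      (auto simp: transition_refl transition_Suc hom)
  have eq: "dirlim_class f (max i' j')
        (oper (transition f i' (max i' j') a') (transition f j' (max i' j') b')) =
      dirlim_class f (max i j)
        (oper (transition f i (max i j) a) (transition f j (max i j) b))"
    if "((i, a), (i', a')) \<in> dirlim_rel f" "((j, b), (j', b')) \<in> dirlim_rel f" for i' a' j' b'
  proof -
    from that obtain m n where
      mn: "i \<le> m" "i' \<le> m" "transition f i m a = transition f i' m a'"
        "j \<le> n" "j' \<le> n" "transition f j n b = transition f j' n b'"
      by (auto simp: dirlim_rel_def)
    obtain q where q: "m \<le> q" "n \<le> q"
      by (meson max.cobounded1 max.cobounded2)
    have le: "i \<le> q" "i' \<le> q" "j \<le> q" "j' \<le> q"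
      using mn q by auto
    have ab: "transition f i q a = transition f i' q a'" "transition f j q b = transition f j' q b'"
      using mn q by (metis transition_trans)+
    have "((max i' j', oper (transition f i' (max i' j') a') (transition f j' (max i' j') b')),
        (max i j, oper (transition f i (max i j) a) (transition f j (max i j) b)))
        \<in> dirlim_rel f"
      using le ab
      by (auto simp: dirlim_rel_def hom' transition_trans intro!: exI[of _ q])
    then show ?thesis
      unfolding dirlim_class_def by (rule equiv_class_eq[OF equiv_dirlim_rel])
  qed
  let ?c = "dirlim_class f (max i j)
      (oper (transition f i (max i j) a) (transition f j (max i j) b))"
  have mem: "(i, a) \<in> dirlim_class f i a" "(j, b) \<in> dirlim_class f j b"
    by (auto simp: dirlim_class_def dirlim_rel_def)
  have "dirlim_op f oper (dirlim_class f i a) (dirlim_class f j b) =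
      (\<Union>x\<in>dirlim_class f i a. \<Union>y\<in>dirlim_class f j b. ?c)"
    unfolding dirlim_op_def
  proof (rule SUP_cong[OF refl], rule prod.case_eq_if[THEN trans], rule SUP_cong[OF refl],
      rule prod.case_eq_if[THEN trans])
    fix x y assume "x \<in> dirlim_class f i a" "y \<in> dirlim_class f j b"
    then show "dirlim_class f (max (fst x) (fst y))
        (oper (transition f (fst x) (max (fst x) (fst y)) (snd x))
          (transition f (fst y) (max (fst x) (fst y)) (snd y))) = ?c"
      by (intro eq) (simp_all add: dirlim_class_def)
  qed
  also have "\<dots> = ?c"
    using mem by blast
  finally show ?thesis .
qed

end

theory Submission
  imports Defs
begin

text \<open>The ring is a Bezout domain, being a direct limit of Euclidean rings, so it is principal as
  soon as the divisors of a fixed \<open>f \<noteq> 0\<close> cannot shrink indefinitely. If \<open>f\<close> lives at stage \<open>n\<close> and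
  its coefficients have degree zero in \<open>\<alpha>\<^sub>n\<^sub>+\<^sub>1\<close>, then at a later stage \<open>m\<close> the Newton polygon of \<open>f\<close>
  with respect to this degree is a single segment of slope \<open>-1/P\<close>, where \<open>P = p\<^sub>n \<cdots> p\<^sub>m\<^sub>-\<^sub>1\<close>. The same
  then holds for every factor, so \<open>P\<close> divides the width of every factor: measured in \<open>t\<^sub>n\<close>, all
  divisors of \<open>f\<close> have integral width.

  If the ring were Euclidean, a nonunit \<open>\<pi>\<close> of minimal norm would leave only zero and units, that
  is monomials, as remainders. Up to constants there are only countably many monomials but
  uncountably many elements \<open>t\<^sub>i + c\<close>, which forces each \<open>t\<^sub>i\<close> to be congruent to a constant \<open>\<tau>\<^sub>i\<close>
  modulo \<open>\<pi>\<close>. Then \<open>\<tau>\<^sub>i\<^sub>+\<^sub>1^(p\<^sub>i) = \<alpha>\<^sub>i\<^sub>+\<^sub>1 \<tau>\<^sub>i\<close> for all \<open>i\<close>, contradicting that \<open>\<tau>\<^sub>0\<close> involves only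
  finitely many indeterminates.\<close>

section \<open>Degrees in one indeterminate\<close>

text \<open>The negative of a discrete valuation, modelled on the degree of a rational function. The
  value at zero is left free, so the rules exclude zero by hypotheses instead of using minus
  infinity.\<close>

locale degree_valuation =
  fixes v :: "'a::field \<Rightarrow> int"
  assumes v_mult: "x \<noteq> 0 \<Longrightarrow> y \<noteq> 0 \<Longrightarrow> v (x * y) = v x + v y"
    and v_add: "x \<noteq> 0 \<Longrightarrow> y \<noteq> 0 \<Longrightarrow> x + y \<noteq> 0 \<Longrightarrow> v (x + y) \<le> max (v x) (v y)"
begin

lemma v_one: "v 1 = 0"
  using v_mult[of 1 1] by simp

lemma v_uminus: "v (- x) = v x"
proof (cases "x = 0")
  case False
  have "v (- 1) = 0"
    using v_mult[of "- 1" "- 1"] v_one by simp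
  then show ?thesis
    using v_mult[of "- 1" x] False by simp
qed simp

lemma v_inverse: "x \<noteq> 0 \<Longrightarrow> v (inverse x) = - v x"
  using v_mult[of x "inverse x"] v_one by simp

lemma v_power: "x \<noteq> 0 \<Longrightarrow> v (x ^ n) = int n * v x"
  by (induction n) (auto simp: v_one v_mult algebra_simps)

lemma v_power_int: "x \<noteq> 0 \<Longrightarrow> v (x powi n) = n * v x"
  by (cases "n \<ge> 0") (auto simp: power_int_def v_power v_inverse power_inverse)

lemma v_add_eq:
  assumes "x \<noteq> 0" "y = 0 \<or> v y < v x"
  shows "x + y \<noteq> 0 \<and> v (x + y) = v x"
proof (cases "y = 0")
  case False
  with assms have y: "y \<noteq> 0" "v y < v x" by auto
  have nz: "x + y \<noteq> 0"
    using y v_uminus[of x] by (metis add_eq_0_iff less_irrefl)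
  \<comment> \<open>Here \<open>x\<close> is read as \<open>(x + y) + (- y)\<close>; since
    \<open>v y < v x\<close>, the maximum must come from \<open>x + y\<close>.\<close>
  have "v x \<le> max (v (x + y)) (v y)"
    using v_add[of "x + y" "- y"] nz y assms v_uminus[of y] by auto
  then show ?thesis
    using v_add[OF assms(1) y(1) nz] nz y by auto
qed (use assms in auto)

text \<open>The bound is a nonzero summand and not a maximum over \<open>A\<close>, because
  \<open>v 0\<close> carries no information.\<close>

lemma v_sum_le:
  assumes "finite A" "sum f A \<noteq> 0"
  shows "\<exists>a\<in>A. f a \<noteq> 0 \<and> v (sum f A) \<le> v (f a)"
  using assms
proof (induction A)
  case (insert a A)
  show ?case
  proof (cases "f a = 0 \<or> sum f A = 0")
    case True
    then show ?thesis using insert by auto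
  next
    case False
    then obtain b where b: "b \<in> A" "f b \<noteq> 0" "v (sum f A) \<le> v (f b)"
      using insert by auto
    have "v (f a + sum f A) \<le> max (v (f a)) (v (sum f A))"
      by (rule v_add) (use insert False in auto)
    then show ?thesis using b insert.hyps False by (auto simp: max_def split: if_splits)
  qed
qed auto

end

section \<open>Degrees of polynomials in one of infinitely many indeterminates\<close>

definition mdeg :: "nat \<Rightarrow> ((nat \<Rightarrow>\<^sub>0 nat) \<Rightarrow>\<^sub>0 'k::zero) \<Rightarrow> nat" where
  "mdeg m a = Max ((\<lambda>e. Poly_Mapping.lookup e m) ` Poly_Mapping.keys a)"

lemma mdeg_ge: "e \<in> Poly_Mapping.keys a \<Longrightarrow> Poly_Mapping.lookup e m \<le> mdeg m a"
  unfolding mdeg_def by (rule Max_ge) auto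

lemma mdeg_leI:
  assumes "a \<noteq> 0" "\<And>e. e \<in> Poly_Mapping.keys a \<Longrightarrow> Poly_Mapping.lookup e m \<le> d"
  shows "mdeg m a \<le> d"
  unfolding mdeg_def using assms by (subst Max_le_iff) auto

lemma keys_nonempty: "a \<noteq> 0 \<Longrightarrow> Poly_Mapping.keys a \<noteq> {}"
  by (metis all_not_in_conv in_keys_iff lookup_zero poly_mapping_eqI)

lemma lookup_mult_keys:
  "Poly_Mapping.lookup (a * b) n =
     (\<Sum>x\<in>Poly_Mapping.keys a. \<Sum>y\<in>Poly_Mapping.keys b.
        Poly_Mapping.lookup a x * Poly_Mapping.lookup b y when n = x + y)"
proof -
  have inner: "(\<Sum>y. Poly_Mapping.lookup b y when n = x + y) =
      (\<Sum>y\<in>Poly_Mapping.keys b. Poly_Mapping.lookup b y when n = x + y)" for x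
    by (rule Sum_any.expand_superset) (auto simp: in_keys_iff)
  have "Poly_Mapping.lookup (a * b) n = (\<Sum>x\<in>Poly_Mapping.keys a. Poly_Mapping.lookup a x *
      (\<Sum>y\<in>Poly_Mapping.keys b. Poly_Mapping.lookup b y when n = x + y))"
    unfolding lookup_mult inner by (rule Sum_any.expand_superset) (auto simp: in_keys_iff)
  then show ?thesis
    by (simp add: sum_distrib_left mult_when)
qed

text \<open>Only one pair of exponents contributes to the convolution at \<open>x + y\<close>, so
  nothing can cancel its term.\<close>

lemma lookup_mult_unique:
  assumes x: "x \<in> Poly_Mapping.keys a" and y: "y \<in> Poly_Mapping.keys b"
    and unique: "\<And>x' y'. x' \<in> Poly_Mapping.keys a \<Longrightarrow> y' \<in> Poly_Mapping.keys b \<Longrightarrow>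
      x' + y' = x + y \<Longrightarrow> x' = x \<and> y' = y"
  shows "Poly_Mapping.lookup (a * b) (x + y) = Poly_Mapping.lookup a x * Poly_Mapping.lookup b y"
proof -
  have "Poly_Mapping.lookup (a * b) (x + y) =
     (\<Sum>x'\<in>Poly_Mapping.keys a. \<Sum>y'\<in>Poly_Mapping.keys b.
        if x' = x then if y' = y then Poly_Mapping.lookup a x * Poly_Mapping.lookup b y else 0 else 0)"
    unfolding lookup_mult_keys
  proof (rule sum.cong[OF refl], rule sum.cong[OF refl])
    fix x' y' assume "x' \<in> Poly_Mapping.keys a" "y' \<in> Poly_Mapping.keys b"
    then have "x + y = x' + y' \<longleftrightarrow> x' = x \<and> y' = y"
      using unique by metis
    then show "(Poly_Mapping.lookup a x' * Poly_Mapping.lookup b y' when x + y = x' + y') =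
        (if x' = x then if y' = y then Poly_Mapping.lookup a x * Poly_Mapping.lookup b y else 0 else 0)"
      by (simp add: when_def)
  qed
  also have "\<dots> = (\<Sum>x'\<in>Poly_Mapping.keys a.
        if x' = x then Poly_Mapping.lookup a x * Poly_Mapping.lookup b y else 0)"
    by (rule sum.cong[OF refl]) (simp add: y)
  also have "\<dots> = Poly_Mapping.lookup a x * Poly_Mapping.lookup b y"
    using x by simp
  finally show ?thesis .
qed

text \<open>Among the exponents of maximal degree in the \<open>m\<close>-th indeterminate the lexicographically
  largest one cannot cancel.\<close>

lemma mdeg_mult:
  fixes a b :: "(nat \<Rightarrow>\<^sub>0 nat) \<Rightarrow>\<^sub>0 'k::idom"
  assumes "a \<noteq> 0" "b \<noteq> 0"
  shows "mdeg m (a * b) = mdeg m a + mdeg m b"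
proof (rule antisym)
  have "\<exists>x\<in>Poly_Mapping.keys c. Poly_Mapping.lookup x m = mdeg m c \<and>
      (\<forall>y\<in>Poly_Mapping.keys c. Poly_Mapping.lookup y m = mdeg m c \<longrightarrow> y \<le> x)"
    if "c \<noteq> 0" for c :: "(nat \<Rightarrow>\<^sub>0 nat) \<Rightarrow>\<^sub>0 'k"
  proof -
    let ?T = "{x \<in> Poly_Mapping.keys c. Poly_Mapping.lookup x m = mdeg m c}"
    have "mdeg m c \<in> (\<lambda>e. Poly_Mapping.lookup e m) ` Poly_Mapping.keys c"
      unfolding mdeg_def by (rule Max_in) (use keys_nonempty[OF that] in auto)
    then have T: "?T \<noteq> {}" "finite ?T" by auto
    have "Max ?T \<in> ?T" by (rule Max_in[OF T(2,1)])
    moreover have "\<forall>y\<in>?T. y \<le> Max ?T" using T by auto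
    ultimately show ?thesis by blast
  qed
  from this[OF assms(1)] this[OF assms(2)] obtain x y where
    x: "x \<in> Poly_Mapping.keys a" "Poly_Mapping.lookup x m = mdeg m a"
      "\<And>z. z \<in> Poly_Mapping.keys a \<Longrightarrow> Poly_Mapping.lookup z m = mdeg m a \<Longrightarrow> z \<le> x" and
    y: "y \<in> Poly_Mapping.keys b" "Poly_Mapping.lookup y m = mdeg m b"
      "\<And>z. z \<in> Poly_Mapping.keys b \<Longrightarrow> Poly_Mapping.lookup z m = mdeg m b \<Longrightarrow> z \<le> y"
    by blast
  have "Poly_Mapping.lookup (a * b) (x + y) = Poly_Mapping.lookup a x * Poly_Mapping.lookup b y"
  proof (rule lookup_mult_unique[OF x(1) y(1)])
    fix x' y' assume *: "x' \<in> Poly_Mapping.keys a" "y' \<in> Poly_Mapping.keys b" "x' + y' = x + y"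
    have "Poly_Mapping.lookup x' m + Poly_Mapping.lookup y' m = mdeg m a + mdeg m b"
      using arg_cong[OF *(3), of "\<lambda>z. Poly_Mapping.lookup z m"] x(2) y(2)
      by (simp add: lookup_add)
    \<comment> \<open>Neither summand exceeds its degree and together they reach the total, so both
      are maximal.\<close>
    with mdeg_ge[OF *(1), of m] mdeg_ge[OF *(2), of m]
    have "Poly_Mapping.lookup x' m = mdeg m a" "Poly_Mapping.lookup y' m = mdeg m b"
      by linarith+
    \<comment> \<open>The order on exponents is compatible with addition, so these bounds and equal
      sums force equality.\<close>
    then have "x' \<le> x" "y' \<le> y" using x y * by auto
    then show "x' = x \<and> y' = y"
      using *(3) by (metis add_le_cancel_left add_le_cancel_right antisym)
  qed
  then have "x + y \<in> Poly_Mapping.keys (a * b)"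
    using x(1) y(1) by (simp add: in_keys_iff)
  from mdeg_ge[OF this, of m] show "mdeg m a + mdeg m b \<le> mdeg m (a * b)"
    using x y by (simp add: lookup_add)
next
  show "mdeg m (a * b) \<le> mdeg m a + mdeg m b"
  proof (rule mdeg_leI)
    fix e assume "e \<in> Poly_Mapping.keys (a * b)"
    then obtain x y where "e = x + y" "x \<in> Poly_Mapping.keys a" "y \<in> Poly_Mapping.keys b"
      using keys_mult[of a b] by blast
    then show "Poly_Mapping.lookup e m \<le> mdeg m a + mdeg m b"
      using mdeg_ge[of x a m] mdeg_ge[of y b m] by (simp add: lookup_add)
  qed (use assms in auto)
qed

lemma mdeg_add:
  assumes "a + b \<noteq> 0"
  shows "mdeg m (a + b) \<le> max (mdeg m a) (mdeg m b)"
proof (rule mdeg_leI[OF assms])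
  fix e assume "e \<in> Poly_Mapping.keys (a + b)"
  then have "e \<in> Poly_Mapping.keys a \<or> e \<in> Poly_Mapping.keys b"
    using Poly_Mapping.keys_add[of a b] by blast
  then show "Poly_Mapping.lookup e m \<le> max (mdeg m a) (mdeg m b)"
    using mdeg_ge[of e a m] mdeg_ge[of e b m] by auto
qed

text \<open>Only finitely many indeterminates occur in a polynomial.\<close>

lemma mdeg_eventually_zero:
  assumes "a \<noteq> 0"
  shows "\<exists>N. \<forall>m\<ge>N. mdeg m a = 0"
proof -
  let ?V = "\<Union>e\<in>Poly_Mapping.keys a. Poly_Mapping.keys e"
  have "finite ?V" by auto
  then obtain N where N: "\<And>m. m \<in> ?V \<Longrightarrow> m < N"
    by (meson finite_nat_set_iff_bounded)
  have "mdeg m a \<le> 0" if "m \<ge> N" for m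
  proof (rule mdeg_leI[OF assms])
    fix e assume "e \<in> Poly_Mapping.keys a"
    then have "m \<notin> Poly_Mapping.keys e"
      using N[of m] that by fastforce
    then show "Poly_Mapping.lookup e m \<le> 0"
      by (simp add: in_keys_iff)
  qed
  then show ?thesis by auto
qed

section \<open>Extension of the degree to the rational function field\<close>

definition vdeg :: "nat \<Rightarrow> 'k::idom ratfun \<Rightarrow> int" where
  "vdeg m x = (THE d. \<exists>a b. a \<noteq> 0 \<and> b \<noteq> 0 \<and> x = Fract a b \<and>
     d = int (mdeg m a) - int (mdeg m b))"

text \<open>Two representations of a fraction satisfy \<open>a * b' = a' * b\<close>; additivity of
  \<open>mdeg\<close> then gives the same difference of degrees, so the description defining
  \<open>vdeg\<close> is unambiguous.\<close>

lemma vdeg_Fract: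
  assumes "a \<noteq> 0" "b \<noteq> 0"
  shows "vdeg m (Fract a b) = int (mdeg m a) - int (mdeg m b)"
  unfolding vdeg_def
proof (rule the_equality)
  fix d assume "\<exists>a' b'. a' \<noteq> 0 \<and> b' \<noteq> 0 \<and> Fract a b = Fract a' b' \<and>
      d = int (mdeg m a') - int (mdeg m b')"
  then obtain a' b' where *: "a' \<noteq> 0" "b' \<noteq> 0" "a * b' = a' * b"
      "d = int (mdeg m a') - int (mdeg m b')"
    using assms by (auto simp: eq_fract)
  have "mdeg m a + mdeg m b' = mdeg m a' + mdeg m b"
    using * assms mdeg_mult by metis
  with * show "d = int (mdeg m a) - int (mdeg m b)" by linarith
qed (use assms in blast)

lemma Fract_nonzero_cases:
  assumes "x \<noteq> (0 :: 'a::idom fract)"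
  obtains a b where "x = Fract a b" "a \<noteq> 0" "b \<noteq> 0"
  using assms by (cases x rule: Fract_cases_nonzero) blast+

text \<open>The index \<open>m\<close> stays free, which yields one degree for each indeterminate.
  Sums are compared over the common denominator \<open>b * d\<close>.\<close>

interpretation vdeg: degree_valuation "vdeg m :: 'k::idom ratfun \<Rightarrow> int"
proof
  fix x y :: "'k ratfun"
  assume "x \<noteq> 0" "y \<noteq> 0"
  then obtain a b c d where *: "x = Fract a b" "a \<noteq> 0" "b \<noteq> 0" "y = Fract c d" "c \<noteq> 0" "d \<noteq> 0"
    by (elim Fract_nonzero_cases) blast
  then show "vdeg m (x * y) = vdeg m x + vdeg m y"
    by (simp add: vdeg_Fract mdeg_mult)
  assume "x + y \<noteq> 0"
  then have nz: "a * d + c * b \<noteq> 0"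
    using * by (auto simp: fract_collapse)
  have "mdeg m (a * d + c * b) \<le> max (mdeg m (a * d)) (mdeg m (c * b))"
    using nz by (rule mdeg_add)
  then show "vdeg m (x + y) \<le> max (vdeg m x) (vdeg m y)"
    using * nz by (auto simp: vdeg_Fract mdeg_mult)
qed

lemma vdeg_alpha: "vdeg m (alpha i :: 'k::idom ratfun) = (if m = i then 1 else 0)"
proof -
  have "Poly_Mapping.single (Poly_Mapping.single i (1::nat)) (1::'k) \<noteq> 0"
    by (metis lookup_single_eq lookup_zero one_neq_zero)
  then show ?thesis
    unfolding alpha_def by (subst vdeg_Fract) (auto simp: mdeg_def lookup_single when_def)
qed

text \<open>The condition \<open>x \<noteq> 0\<close> stands inside the quantifiers so that a bound
  \<open>N\<close> can be chosen for every coefficient of a Laurent polynomial at once, including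
  the vanishing ones.\<close>

lemma vdeg_eventually_zero: "\<exists>N. \<forall>m\<ge>N. x \<noteq> 0 \<longrightarrow> vdeg m x = 0"
proof (cases "x = 0")
  case False
  then obtain a b where x: "x = Fract a b" "a \<noteq> 0" "b \<noteq> 0"
    by (elim Fract_nonzero_cases) blast
  obtain N M where "\<forall>m\<ge>N. mdeg m a = 0" "\<forall>m\<ge>M. mdeg m b = 0"
    using mdeg_eventually_zero[OF x(2)] mdeg_eventually_zero[OF x(3)] by blast
  then have "\<forall>m\<ge>max N M. vdeg m x = 0"
    using x by (auto simp: vdeg_Fract)
  then show ?thesis by blast
qed auto

section \<open>Laurent polynomials over a field\<close>

definition top_exp :: "(int \<Rightarrow>\<^sub>0 'a::zero) \<Rightarrow> int" where
  "top_exp g = Max (Poly_Mapping.keys g)"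

definition bot_exp :: "(int \<Rightarrow>\<^sub>0 'a::zero) \<Rightarrow> int" where
  "bot_exp g = Min (Poly_Mapping.keys g)"

text \<open>This is the Euclidean size of a Laurent polynomial: unlike the top exponent, it is
  unchanged by monomial factors, which are units.\<close>

definition width :: "(int \<Rightarrow>\<^sub>0 'a::zero) \<Rightarrow> int" where
  "width g = top_exp g - bot_exp g"

lemma top_exp_in: "g \<noteq> 0 \<Longrightarrow> top_exp g \<in> Poly_Mapping.keys g"
  unfolding top_exp_def by (rule Max_in) (auto dest: keys_nonempty)

lemma bot_exp_in: "g \<noteq> 0 \<Longrightarrow> bot_exp g \<in> Poly_Mapping.keys g"
  unfolding bot_exp_def by (rule Min_in) (auto dest: keys_nonempty)

lemma le_top_exp: "k \<in> Poly_Mapping.keys g \<Longrightarrow> k \<le> top_exp g"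
  unfolding top_exp_def by (rule Max_ge) auto

lemma bot_exp_le: "k \<in> Poly_Mapping.keys g \<Longrightarrow> bot_exp g \<le> k"
  unfolding bot_exp_def by (rule Min_le) auto

lemma width_nonneg: "g \<noteq> 0 \<Longrightarrow> width g \<ge> 0"
  unfolding width_def using bot_exp_le[OF top_exp_in] by fastforce

lemma width_eq_0_imp_monomial:
  assumes "g \<noteq> 0" "width g = 0"
  shows "\<exists>k c. c \<noteq> 0 \<and> g = Poly_Mapping.single k c"
proof -
  have "k = top_exp g" if "k \<in> Poly_Mapping.keys g" for k
    using le_top_exp[OF that] bot_exp_le[OF that] assms(2) by (simp add: width_def)
  then have "g = Poly_Mapping.single (top_exp g) (Poly_Mapping.lookup g (top_exp g))"
    by (intro poly_mapping_eqI) (auto simp: lookup_single when_def in_keys_iff)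
  moreover have "Poly_Mapping.lookup g (top_exp g) \<noteq> 0"
    using top_exp_in[OF assms(1)] by (simp add: in_keys_iff)
  ultimately show ?thesis by blast
qed

text \<open>Integer exponents can be subtracted, so the inner sum of the convolution has the single
  index \<open>n - k\<close>.\<close>

lemma lookup_mult_int:
  fixes g h :: "int \<Rightarrow>\<^sub>0 'a::semiring_0"
  shows "Poly_Mapping.lookup (g * h) n =
    (\<Sum>k\<in>Poly_Mapping.keys g. Poly_Mapping.lookup g k * Poly_Mapping.lookup h (n - k))"
  unfolding lookup_mult_keys
proof (rule sum.cong[OF refl])
  fix k
  have "(\<Sum>l\<in>Poly_Mapping.keys h. Poly_Mapping.lookup g k * Poly_Mapping.lookup h l when n = k + l)
     = (\<Sum>l\<in>Poly_Mapping.keys h. if l = n - k then Poly_Mapping.lookup g k * Poly_Mapping.lookup h l else 0)"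
    by (rule sum.cong[OF refl]) (auto simp: when_def)
  also have "\<dots> = Poly_Mapping.lookup g k * Poly_Mapping.lookup h (n - k)"
    by (auto simp: in_keys_iff)
  finally show "(\<Sum>l\<in>Poly_Mapping.keys h. Poly_Mapping.lookup g k * Poly_Mapping.lookup h l when n = k + l)
     = Poly_Mapping.lookup g k * Poly_Mapping.lookup h (n - k)" .
qed

lemma lookup_single_mult:
  fixes b :: "int \<Rightarrow>\<^sub>0 'a::semiring_0"
  shows "Poly_Mapping.lookup (Poly_Mapping.single m c * b) n = c * Poly_Mapping.lookup b (n - m)"
  by (cases "c = 0") (simp_all add: lookup_mult_int)

section \<open>Vertices of Newton polygons under multiplication\<close>

context degree_valuation
begin

text \<open>Points \<open>(k, v g\<^sub>k)\<close> of the Newton polygon of \<open>g\<close> where the linear functional with weights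
  \<open>c\<close> and \<open>e\<close> is maximal; ties are broken by the sign of \<open>s\<close>.\<close>

definition peak :: "int \<Rightarrow> int \<Rightarrow> int \<Rightarrow> (int \<Rightarrow>\<^sub>0 'a) \<Rightarrow> int \<Rightarrow> bool" where
  "peak c e s g j \<longleftrightarrow> j \<in> Poly_Mapping.keys g \<and> (\<forall>k\<in>Poly_Mapping.keys g. k \<noteq> j \<longrightarrow>
     c * v (Poly_Mapping.lookup g k) + e * k < c * v (Poly_Mapping.lookup g j) + e * j \<or>
     c * v (Poly_Mapping.lookup g k) + e * k = c * v (Poly_Mapping.lookup g j) + e * j \<and> s * k < s * j)"

text \<open>First the weight is maximised, then \<open>s * k\<close> among the ties; as
  \<open>s \<noteq> 0\<close>, distinct exponents never tie in both.\<close>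

lemma peak_exists:
  assumes "g \<noteq> 0" "s \<noteq> 0"
  shows "\<exists>j. peak c e s g j"
proof -
  let ?K = "Poly_Mapping.keys g"
  let ?w = "\<lambda>k. c * v (Poly_Mapping.lookup g k) + e * k"
  let ?T = "{k \<in> ?K. ?w k = Max (?w ` ?K)}"
  have "Max (?w ` ?K) \<in> ?w ` ?K"
    by (rule Max_in) (use keys_nonempty[OF assms(1)] in auto)
  then have T: "finite ?T" "?T \<noteq> {}" by auto
  have "Max ((\<lambda>k. s * k) ` ?T) \<in> (\<lambda>k. s * k) ` ?T"
    by (rule Max_in) (use T in auto)
  then obtain j where j: "j \<in> ?T" "s * j = Max ((\<lambda>k. s * k) ` ?T)" by auto
  have "?w k < ?w j \<or> ?w k = ?w j \<and> s * k < s * j" if "k \<in> ?K" "k \<noteq> j" for k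
  proof -
    have "?w k \<le> Max (?w ` ?K)" by (rule Max_ge) (use that in auto)
    moreover have "s * k \<le> s * j" if "k \<in> ?T"
      unfolding j(2) by (rule Max_ge) (use that T in auto)
    moreover have "s * k \<noteq> s * j" using that(2) assms(2) by simp
    ultimately show ?thesis using j(1) that(1)
      by (smt (verit) mem_Collect_eq)
  qed
  then show ?thesis using j(1) unfolding peak_def by blast
qed

lemma peak_unique: "peak c e s g j \<Longrightarrow> peak c e s g k \<Longrightarrow> j = k"
  unfolding peak_def by (metis less_asym less_irrefl)

text \<open>A form of Dumas' theorem that Newton polygons add under multiplication. The term coming
  from the two peaks strictly dominates all others, and \<open>c \<ge> 0\<close> turns bounds on
  degrees into bounds on weights.\<close>

lemma peak_mult:
  assumes g: "peak c e s g j" and h: "peak c e s h l" and c: "c \<ge> 0"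
  shows "peak c e s (g * h) (j + l)"
proof -
  let ?w = "\<lambda>x k. c * v x + e * k"
  let ?t = "\<lambda>n k. Poly_Mapping.lookup g k * Poly_Mapping.lookup h (n - k)"
  let ?G = "Poly_Mapping.keys g"
  have nz: "Poly_Mapping.lookup g j \<noteq> 0" "Poly_Mapping.lookup h l \<noteq> 0"
    using g h by (auto simp: peak_def in_keys_iff)
  define m where "m = Poly_Mapping.lookup g j * Poly_Mapping.lookup h l"
  have m: "m \<noteq> 0" "v m = v (Poly_Mapping.lookup g j) + v (Poly_Mapping.lookup h l)"
    using nz by (auto simp: m_def v_mult)
  \<comment> \<open>Weight and tie-breaker are both additive over the two factors, and at least one
    factor is away from its peak.\<close>
  have less: "?w (?t n k) n < ?w m (j + l) \<or> ?w (?t n k) n = ?w m (j + l) \<and> s * n < s * (j + l)"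
    if "?t n k \<noteq> 0" "\<not> (k = j \<and> n = j + l)" for n k
  proof -
    have *: "k \<in> ?G" "n - k \<in> Poly_Mapping.keys h"
      using that(1) by (auto simp: in_keys_iff)
    have "?w (?t n k) n = ?w (Poly_Mapping.lookup g k) k + ?w (Poly_Mapping.lookup h (n - k)) (n - k)"
      using that(1) by (simp add: v_mult algebra_simps)
    moreover have "?w m (j + l) = ?w (Poly_Mapping.lookup g j) j + ?w (Poly_Mapping.lookup h l) l"
      using m by (simp add: algebra_simps)
    moreover have "s * n = s * k + s * (n - k)" "s * (j + l) = s * j + s * l"
      by (simp_all add: algebra_simps)
    moreover have "k = j \<or> ?w (Poly_Mapping.lookup g k) k < ?w (Poly_Mapping.lookup g j) j \<or>
        ?w (Poly_Mapping.lookup g k) k = ?w (Poly_Mapping.lookup g j) j \<and> s * k < s * j"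
      using g * by (auto simp: peak_def)
    moreover have "n - k = l \<or> ?w (Poly_Mapping.lookup h (n - k)) (n - k) < ?w (Poly_Mapping.lookup h l) l \<or>
        ?w (Poly_Mapping.lookup h (n - k)) (n - k) = ?w (Poly_Mapping.lookup h l) l \<and> s * (n - k) < s * l"
      using h * by (auto simp: peak_def)
    moreover have "\<not> (k = j \<and> n - k = l)" using that(2) by auto
    ultimately show ?thesis
      by (elim disjE) auto
  qed
  have other: "?w (Poly_Mapping.lookup (g * h) n) n < ?w m (j + l) \<or>
      ?w (Poly_Mapping.lookup (g * h) n) n = ?w m (j + l) \<and> s * n < s * (j + l)"
    if "n \<in> Poly_Mapping.keys (g * h)" "n \<noteq> j + l" for n
  proof -
    have "sum (?t n) ?G \<noteq> 0"
      using that(1) by (simp add: in_keys_iff lookup_mult_int)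
    then obtain k where k: "?t n k \<noteq> 0" "v (sum (?t n) ?G) \<le> v (?t n k)"
      using v_sum_le[of ?G "?t n"] by auto
    have "c * v (sum (?t n) ?G) \<le> c * v (?t n k)"
      by (rule mult_left_mono[OF k(2) c])
    then show ?thesis
      using less[OF k(1)] that(2) unfolding lookup_mult_int by linarith
  qed
  have jG: "j \<in> ?G" using g by (simp add: peak_def)
  let ?r = "sum (?t (j + l)) (?G - {j})"
  have split: "Poly_Mapping.lookup (g * h) (j + l) = m + ?r"
    unfolding lookup_mult_int m_def using jG by (subst sum.remove[of _ j]) auto
  \<comment> \<open>At the fixed exponent \<open>j + l\<close> the tie-breaker and the part with
    \<open>e\<close> agree, so strict dominance must come from the degree. For \<open>c = 0\<close>
    this leaves no other nonzero term.\<close>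
  have "?r = 0 \<or> v ?r < v m"
  proof (rule disjCI)
    assume "\<not> v ?r < v m"
    show "?r = 0"
    proof (rule ccontr)
      assume "?r \<noteq> 0"
      then obtain k where k: "k \<noteq> j" "?t (j + l) k \<noteq> 0" "v ?r \<le> v (?t (j + l) k)"
        using v_sum_le[of "?G - {j}" "?t (j + l)"] by auto
      have "c * v (?t (j + l) k) < c * v m"
        using less[OF k(2)] k(1) by auto
      then have "v (?t (j + l) k) < v m"
        using c by (simp add: mult_less_cancel_left)
      then show False using k(3) \<open>\<not> v ?r < v m\<close> by linarith
    qed
  qed
  from v_add_eq[OF m(1) this] have "m + ?r \<noteq> 0" "v (m + ?r) = v m" by auto
  then show ?thesis
    unfolding peak_def using other split by (auto simp: in_keys_iff)
qed

text \<open>With both weights zero every exponent ties, and the sign of \<open>s\<close> alone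
  selects an end of the support.\<close>

lemma peak_top_exp: "g \<noteq> 0 \<Longrightarrow> peak 0 0 1 g (top_exp g)"
  by (auto simp: peak_def top_exp_in dest: le_top_exp)

lemma peak_bot_exp: "g \<noteq> 0 \<Longrightarrow> peak 0 0 (- 1) g (bot_exp g)"
  by (auto simp: peak_def bot_exp_in dest: bot_exp_le)

end

text \<open>The zero degree specialises \<open>peak_mult\<close> to additivity of top and bottom
  exponents over any field.\<close>

interpretation trivial: degree_valuation "\<lambda>_ :: 'a::field. 0"
  by unfold_locales auto

section \<open>Widths, units and division of Laurent polynomials\<close>

lemma top_exp_mult:
  fixes g h :: "int \<Rightarrow>\<^sub>0 'a::field"
  assumes "g \<noteq> 0" "h \<noteq> 0"
  shows "top_exp (g * h) = top_exp g + top_exp h"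
  using assms trivial.peak_mult[OF trivial.peak_top_exp trivial.peak_top_exp, of g h]
  by (intro trivial.peak_unique[OF trivial.peak_top_exp]) auto

lemma bot_exp_mult:
  fixes g h :: "int \<Rightarrow>\<^sub>0 'a::field"
  assumes "g \<noteq> 0" "h \<noteq> 0"
  shows "bot_exp (g * h) = bot_exp g + bot_exp h"
  using assms trivial.peak_mult[OF trivial.peak_bot_exp trivial.peak_bot_exp, of g h]
  by (intro trivial.peak_unique[OF trivial.peak_bot_exp]) auto

lemma width_mult:
  fixes g h :: "int \<Rightarrow>\<^sub>0 'a::field"
  assumes "g \<noteq> 0" "h \<noteq> 0"
  shows "width (g * h) = width g + width h"
  using assms by (simp add: width_def top_exp_mult bot_exp_mult)

text \<open>The widths of the two factors are nonnegative and add up to the width of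
  \<open>1\<close>, which is zero.\<close>

lemma unit_imp_monomial:
  fixes g h :: "int \<Rightarrow>\<^sub>0 'a::field"
  assumes "g * h = 1"
  shows "\<exists>k c. c \<noteq> 0 \<and> g = Poly_Mapping.single k c"
proof -
  have nz: "g \<noteq> 0" "h \<noteq> 0" using assms by auto
  have "width (1 :: int \<Rightarrow>\<^sub>0 'a) = 0"
    by (simp add: width_def top_exp_def bot_exp_def)
  then have "width g = 0"
    using width_mult[OF nz] width_nonneg[OF nz(1)] width_nonneg[OF nz(2)] assms by simp
  then show ?thesis by (rule width_eq_0_imp_monomial[OF nz(1)])
qed

lemma monomial_unit:
  fixes c :: "'a::field" and k :: int
  assumes "c \<noteq> 0"
  shows "Poly_Mapping.single k c * Poly_Mapping.single (- k) (inverse c) = 1"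
  using assms by (simp add: mult_single)

text \<open>Long division with \<open>width\<close> as the decreasing measure. The quotient monomial
  \<open>q\<close> aligns the top exponents and cancels the top coefficient; its exponent
  \<open>m\<close> may be negative.\<close>

lemma laurent_division:
  fixes a b :: "int \<Rightarrow>\<^sub>0 'a::field"
  assumes "b \<noteq> 0"
  shows "\<exists>q. a - q * b = 0 \<or> width (a - q * b) < width b"
proof (induction "nat (width a)" arbitrary: a rule: less_induct)
  case less
  show ?case
  proof (cases "a = 0 \<or> width a < width b")
    case True
    then show ?thesis by (intro exI[of _ 0]) auto
  next
    case False
    define m where "m = top_exp a - top_exp b"
    define c where "c = Poly_Mapping.lookup a (top_exp a) / Poly_Mapping.lookup b (top_exp b)"
    define q where "q = Poly_Mapping.single m c"
    have b: "Poly_Mapping.lookup b (top_exp b) \<noteq> 0"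
      using top_exp_in[OF assms] by (simp add: in_keys_iff)
    have keys: "bot_exp a \<le> k \<and> k < top_exp a" if "k \<in> Poly_Mapping.keys (a - q * b)" for k
    proof -
      have l: "Poly_Mapping.lookup (a - q * b) k =
          Poly_Mapping.lookup a k - c * Poly_Mapping.lookup b (k - m)"
        by (simp add: lookup_minus q_def lookup_single_mult)
      with that have nz: "Poly_Mapping.lookup a k - c * Poly_Mapping.lookup b (k - m) \<noteq> 0"
        by (simp add: in_keys_iff)
      then have "k \<noteq> top_exp a"
        using b by (auto simp: m_def c_def)
      moreover have "k \<in> Poly_Mapping.keys a \<or> k - m \<in> Poly_Mapping.keys b"
        using nz by (auto simp: in_keys_iff)
      \<comment> \<open>Since \<open>b\<close> is no wider than \<open>a\<close>, the shifted copy
        of \<open>b\<close> with the same top exponent does not reach below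
        \<open>bot_exp a\<close>.\<close>
      then have "bot_exp a \<le> k \<and> k \<le> top_exp a"
      proof
        assume "k - m \<in> Poly_Mapping.keys b"
        from le_top_exp[OF this] bot_exp_le[OF this] False show ?thesis
          by (auto simp: m_def width_def)
      qed (auto dest: le_top_exp bot_exp_le)
      ultimately show ?thesis by auto
    qed
    show ?thesis
    proof (cases "a - q * b = 0")
      case nonzero: False
      have "width (a - q * b) < width a"
        using keys[OF top_exp_in[OF nonzero]] keys[OF bot_exp_in[OF nonzero]]
        by (simp add: width_def)
      then have "nat (width (a - q * b)) < nat (width a)"
        using width_nonneg[OF nonzero] by simp
      from less[OF this] obtain q' where
        "a - q * b - q' * b = 0 \<or> width (a - q * b - q' * b) < width b" by blast
      moreover have "a - q * b - q' * b = a - (q + q') * b"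
        by (simp add: algebra_simps)
      ultimately show ?thesis by metis
    qed blast
  qed
qed

text \<open>A nonzero combination of least width divides both elements, because remainders are again
  combinations.\<close>

lemma laurent_bezout:
  fixes a b :: "int \<Rightarrow>\<^sub>0 'a::field"
  shows "\<exists>d u w. d = u * a + w * b \<and> d dvd a \<and> d dvd b"
proof (cases "a = 0 \<and> b = 0")
  case False
  define S where "S = {x. \<exists>u w. x = u * a + w * b}"
  have ab: "a \<in> S" "b \<in> S"
    unfolding S_def by (auto intro: exI[of _ 1] exI[of _ 0])
  have closed: "x - q * y \<in> S" if xy: "x \<in> S" "y \<in> S" for x y q
  proof -
    obtain u w u' w' where "x = u * a + w * b" "y = u' * a + w' * b"
      using xy by (auto simp: S_def)
    then have "x - q * y = (u - q * u') * a + (w - q * w') * b"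
      by (simp add: algebra_simps)
    then show ?thesis by (auto simp: S_def)
  qed
  obtain y where "y \<in> S \<and> y \<noteq> 0" using ab False by auto
  from ex_has_least_nat[of "\<lambda>x. x \<in> S \<and> x \<noteq> 0", OF this, of "\<lambda>x. nat (width x)"] obtain d where
    d: "d \<in> S" "d \<noteq> 0" "\<And>x. x \<in> S \<Longrightarrow> x \<noteq> 0 \<Longrightarrow> nat (width d) \<le> nat (width x)"
    by auto
  have "d dvd x" if x: "x \<in> S" for x
  proof -
    obtain q where q: "x - q * d = 0 \<or> width (x - q * d) < width d"
      using laurent_division[OF d(2)] by blast
    have "x - q * d = 0"
    proof (rule ccontr)
      assume nz: "x - q * d \<noteq> 0"
      then show False
        using d(3)[OF closed[OF x d(1)] nz] q width_nonneg[OF nz] by auto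
    qed
    then show ?thesis by auto
  qed
  then show ?thesis using d(1) ab by (auto simp: S_def)
qed (auto intro: exI[of _ 0])

section \<open>Newton polygons consisting of a single segment\<close>

context degree_valuation
begin

text \<open>The upper Newton polygon is a single segment of slope \<open>-1/P\<close>.\<close>

definition straight :: "int \<Rightarrow> (int \<Rightarrow>\<^sub>0 'a) \<Rightarrow> bool" where
  "straight P g \<longleftrightarrow> peak P 1 1 g (top_exp g) \<and> peak P 1 (- 1) g (bot_exp g)"

text \<open>Peaks add, and so do top exponents. A peak never lies beyond the top exponent, so
  equality for the product forces equality for each factor; the bottom end is symmetric.\<close>

lemma straight_factor:
  assumes "straight P (g * h)" "g \<noteq> 0" "h \<noteq> 0" "P \<ge> 0"
  shows "straight P g"
proof -
  obtain j l where jl: "peak P 1 1 g j" "peak P 1 1 h l"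
    using peak_exists[OF assms(2), of 1 P 1] peak_exists[OF assms(3), of 1 P 1] by auto
  have "j + l = top_exp g + top_exp h"
    using peak_unique[OF peak_mult[OF jl assms(4)]] assms by (simp add: straight_def top_exp_mult)
  moreover have "j \<le> top_exp g" "l \<le> top_exp h"
    using jl by (auto simp: peak_def intro: le_top_exp)
  ultimately have "j = top_exp g" by linarith
  with jl have top: "peak P 1 1 g (top_exp g)" by simp
  obtain j l where jl: "peak P 1 (- 1) g j" "peak P 1 (- 1) h l"
    using peak_exists[OF assms(2), of "- 1" P 1] peak_exists[OF assms(3), of "- 1" P 1] by auto
  have "j + l = bot_exp g + bot_exp h"
    using peak_unique[OF peak_mult[OF jl assms(4)]] assms by (simp add: straight_def bot_exp_mult)
  moreover have "bot_exp g \<le> j" "bot_exp h \<le> l"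
    using jl by (auto simp: peak_def intro: bot_exp_le)
  ultimately have "j = bot_exp g" by linarith
  with jl top show ?thesis by (simp add: straight_def)
qed

text \<open>Each end dominates the other, so both have the same weight; the difference of their
  exponents is then \<open>P\<close> times an integer difference of degrees.\<close>

lemma straight_dvd_width:
  assumes "straight P g"
  shows "P dvd width g"
proof -
  let ?w = "\<lambda>k. P * v (Poly_Mapping.lookup g k) + k"
  have "?w (top_exp g) = ?w (bot_exp g)"
    using assms unfolding straight_def peak_def by (smt (verit) mult_1)
  then have "width g = P * (v (Poly_Mapping.lookup g (bot_exp g)) - v (Poly_Mapping.lookup g (top_exp g)))"
    by (simp add: width_def algebra_simps)
  then show ?thesis by simp
qed

lemma straightI:
  assumes "g \<noteq> 0" "\<And>k. k \<in> Poly_Mapping.keys g \<Longrightarrow> P * v (Poly_Mapping.lookup g k) + k = 0"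
  shows "straight P g"
  unfolding straight_def peak_def using assms
  by (auto simp: top_exp_in bot_exp_in order.not_eq_order_implies_strict le_top_exp bot_exp_le)

end

section \<open>Direct limits along ring homomorphisms\<close>

locale direct_system =
  fixes f :: "nat \<Rightarrow> 'r::comm_ring_1 \<Rightarrow> 'r"
  assumes f_add: "f i (a + b) = f i a + f i b"
    and f_mult: "f i (a * b) = f i a * f i b"
    and f_one: "f i 1 = 1"
begin

abbreviation tr :: "nat \<Rightarrow> nat \<Rightarrow> 'r \<Rightarrow> 'r" where "tr \<equiv> transition f"

abbreviation cl :: "nat \<Rightarrow> 'r \<Rightarrow> (nat \<times> 'r) set" where "cl \<equiv> dirlim_class f"

lemma f_zero: "f i 0 = 0"
  using f_add[of i 0 0] by simp

lemma
  assumes "i \<le> j"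
  shows tr_add: "tr i j (a + b) = tr i j a + tr i j b"
    and tr_mult: "tr i j (a * b) = tr i j a * tr i j b"
    and tr_one: "tr i j 1 = 1"
    and tr_zero: "tr i j 0 = 0"
  using assms by (induction j rule: dec_induct)
    (auto simp: transition_refl transition_Suc f_add f_mult f_one f_zero)

lemma tr_uminus: "i \<le> j \<Longrightarrow> tr i j (- a) = - tr i j a"
  using tr_add[of i j a "- a"] tr_zero[of i j] by (simp add: eq_neg_iff_add_eq_0 add.commute)

lemma tr_diff: "i \<le> j \<Longrightarrow> tr i j (a - b) = tr i j a - tr i j b"
  using tr_add[of i j a "- b"] by (simp add: tr_uminus)

lemma tr_power: "i \<le> j \<Longrightarrow> tr i j (a ^ n) = tr i j a ^ n"
  by (induction n) (auto simp: tr_one tr_mult)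

lemma tr_dvd: "i \<le> j \<Longrightarrow> a dvd b \<Longrightarrow> tr i j a dvd tr i j b"
  by (auto simp: dvd_def tr_mult)

lemma cl_eq_iff:
  "cl i a = cl j b \<longleftrightarrow> (\<exists>n. i \<le> n \<and> j \<le> n \<and> tr i n a = tr j n b)"
  unfolding dirlim_class_def by (subst eq_equiv_class_iff[OF equiv_dirlim_rel])
    (auto simp: dirlim_rel_def)

lemma cl_tr: "i \<le> j \<Longrightarrow> cl j (tr i j a) = cl i a"
  by (auto simp: cl_eq_iff transition_refl intro!: exI[of _ j])

lemma carrier_dirlim: "carrier (dirlim f) = {cl i a | i a. True}"
  unfolding dirlim_def dirlim_class_def quotient_def by auto

lemma cl_carrier: "cl i a \<in> carrier (dirlim f)"
  unfolding carrier_dirlim by blast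

lemma cl_mult: "cl i a \<otimes>\<^bsub>dirlim f\<^esub> cl i b = cl i (a * b)"
  unfolding dirlim_def by (simp add: dirlim_op_class f_mult transition_refl)

lemma cl_add: "cl i a \<oplus>\<^bsub>dirlim f\<^esub> cl i b = cl i (a + b)"
  unfolding dirlim_def by (simp add: dirlim_op_class f_add transition_refl)

lemma cl_zero: "\<zero>\<^bsub>dirlim f\<^esub> = cl i 0"
  using cl_tr[of 0 i 0] by (simp add: dirlim_def tr_zero)

lemma cl_one: "\<one>\<^bsub>dirlim f\<^esub> = cl i 1"
  using cl_tr[of 0 i 1] by (simp add: dirlim_def tr_one)

text \<open>Representatives can be pushed to later stages, so a lower bound \<open>k\<close> may be
  prescribed. The variants below bring several elements to a common stage.\<close>

lemma carrierE:
  assumes "x \<in> carrier (dirlim f)"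
  obtains i a where "x = cl i a" "k \<le> i"
proof -
  from assms obtain i a where "x = cl i a" by (auto simp: carrier_dirlim)
  then have "x = cl (max i k) (tr i (max i k) a)" by (simp add: cl_tr)
  then show ?thesis by (rule that) simp
qed

lemma carrierE2:
  assumes "x \<in> carrier (dirlim f)" "y \<in> carrier (dirlim f)"
  obtains i a b where "x = cl i a" "y = cl i b" "k \<le> i"
proof -
  obtain i a where 1: "x = cl i a" "k \<le> i" using assms(1) by (rule carrierE)
  obtain j b where 2: "y = cl j b" "i \<le> j" using assms(2) by (rule carrierE)
  show ?thesis by (rule that[of j "tr i j a" b]) (use 1 2 in \<open>auto simp: cl_tr\<close>)
qed

lemma carrierE3:
  assumes "x \<in> carrier (dirlim f)" "y \<in> carrier (dirlim f)" "z \<in> carrier (dirlim f)"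
  obtains i a b c where "x = cl i a" "y = cl i b" "z = cl i c"
proof -
  obtain i a b where 1: "x = cl i a" "y = cl i b" using assms(1,2) by (rule carrierE2)
  obtain j c where 2: "z = cl j c" "i \<le> j" using assms(3) by (rule carrierE)
  show ?thesis by (rule that[of j "tr i j a" "tr i j b" c]) (use 1 2 in \<open>auto simp: cl_tr\<close>)
qed

text \<open>Each axiom involves at most three elements and is inherited from a common stage.\<close>

lemma cring_dirlim: "cring (dirlim f)"
proof (rule cringI)
  show "abelian_group (dirlim f)"
  proof (rule abelian_groupI)
    fix x y assume "x \<in> carrier (dirlim f)" "y \<in> carrier (dirlim f)"
    then obtain i a b where "x = cl i a" "y = cl i b" by (rule carrierE2)
    then show "x \<oplus>\<^bsub>dirlim f\<^esub> y \<in> carrier (dirlim f)"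
      "x \<oplus>\<^bsub>dirlim f\<^esub> y = y \<oplus>\<^bsub>dirlim f\<^esub> x"
      by (simp_all add: cl_add cl_carrier add.commute)
  next
    show "\<zero>\<^bsub>dirlim f\<^esub> \<in> carrier (dirlim f)" by (simp add: cl_zero[of 0] cl_carrier)
  next
    fix x y z assume "x \<in> carrier (dirlim f)" "y \<in> carrier (dirlim f)" "z \<in> carrier (dirlim f)"
    then obtain i a b c where "x = cl i a" "y = cl i b" "z = cl i c" by (rule carrierE3)
    then show "x \<oplus>\<^bsub>dirlim f\<^esub> y \<oplus>\<^bsub>dirlim f\<^esub> z = x \<oplus>\<^bsub>dirlim f\<^esub> (y \<oplus>\<^bsub>dirlim f\<^esub> z)"
      by (simp add: cl_add add.assoc)
  next
    fix x assume "x \<in> carrier (dirlim f)"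
    then obtain i a where x: "x = cl i a" by (rule carrierE)
    then show "\<zero>\<^bsub>dirlim f\<^esub> \<oplus>\<^bsub>dirlim f\<^esub> x = x"
      by (simp add: cl_zero[of i] cl_add)
    show "\<exists>y\<in>carrier (dirlim f). y \<oplus>\<^bsub>dirlim f\<^esub> x = \<zero>\<^bsub>dirlim f\<^esub>"
      by (rule bexI[of _ "cl i (- a)"]) (simp_all add: x cl_add cl_zero[of i] cl_carrier)
  qed
  show "comm_monoid (dirlim f)"
  proof (rule comm_monoidI)
    fix x y assume "x \<in> carrier (dirlim f)" "y \<in> carrier (dirlim f)"
    then obtain i a b where "x = cl i a" "y = cl i b" by (rule carrierE2)
    then show "x \<otimes>\<^bsub>dirlim f\<^esub> y \<in> carrier (dirlim f)"
      "x \<otimes>\<^bsub>dirlim f\<^esub> y = y \<otimes>\<^bsub>dirlim f\<^esub> x"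
      by (simp_all add: cl_mult cl_carrier mult.commute)
  next
    show "\<one>\<^bsub>dirlim f\<^esub> \<in> carrier (dirlim f)" by (simp add: cl_one[of 0] cl_carrier)
  next
    fix x y z assume "x \<in> carrier (dirlim f)" "y \<in> carrier (dirlim f)" "z \<in> carrier (dirlim f)"
    then obtain i a b c where "x = cl i a" "y = cl i b" "z = cl i c" by (rule carrierE3)
    then show "x \<otimes>\<^bsub>dirlim f\<^esub> y \<otimes>\<^bsub>dirlim f\<^esub> z = x \<otimes>\<^bsub>dirlim f\<^esub> (y \<otimes>\<^bsub>dirlim f\<^esub> z)"
      by (simp add: cl_mult mult.assoc)
  next
    fix x assume "x \<in> carrier (dirlim f)"
    then obtain i a where x: "x = cl i a" by (rule carrierE)
    then show "\<one>\<^bsub>dirlim f\<^esub> \<otimes>\<^bsub>dirlim f\<^esub> x = x"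
      by (simp add: cl_one[of i] cl_mult)
  qed
  fix x y z assume "x \<in> carrier (dirlim f)" "y \<in> carrier (dirlim f)" "z \<in> carrier (dirlim f)"
  then obtain i a b c where "x = cl i a" "y = cl i b" "z = cl i c" by (rule carrierE3)
  then show "(x \<oplus>\<^bsub>dirlim f\<^esub> y) \<otimes>\<^bsub>dirlim f\<^esub> z =
      x \<otimes>\<^bsub>dirlim f\<^esub> z \<oplus>\<^bsub>dirlim f\<^esub> y \<otimes>\<^bsub>dirlim f\<^esub> z"
    by (simp add: cl_add cl_mult distrib_right)
qed

end

text \<open>Injectivity allows equality in the limit to be tested at any common stage.\<close>

locale injective_direct_system = direct_system f
  for f :: "nat \<Rightarrow> 'r::idom \<Rightarrow> 'r" +
  assumes f_inj: "f i a = 0 \<Longrightarrow> a = 0"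
begin

lemma tr_eq_0: "i \<le> j \<Longrightarrow> tr i j a = 0 \<longleftrightarrow> a = 0"
  by (induction j rule: dec_induct) (auto simp: transition_refl transition_Suc f_zero dest: f_inj)

lemma tr_eq_iff: "i \<le> j \<Longrightarrow> tr i j a = tr i j b \<longleftrightarrow> a = b"
  using tr_eq_0[of i j "a - b"] by (simp add: tr_diff)

lemma cl_inject: "cl i a = cl i b \<longleftrightarrow> a = b"
  by (auto simp: cl_eq_iff tr_eq_iff)

lemma cl_eq_zero: "cl i a = \<zero>\<^bsub>dirlim f\<^esub> \<longleftrightarrow> a = 0"
  by (simp add: cl_zero[of i] cl_inject)

lemma domain_dirlim: "domain (dirlim f)"
proof -
  interpret cring "dirlim f" by (rule cring_dirlim)
  show ?thesis
  proof
    show "\<one>\<^bsub>dirlim f\<^esub> \<noteq> \<zero>\<^bsub>dirlim f\<^esub>"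
      by (simp add: cl_one[of 0] cl_eq_zero)
    fix x y assume *: "x \<otimes>\<^bsub>dirlim f\<^esub> y = \<zero>\<^bsub>dirlim f\<^esub>" "x \<in> carrier (dirlim f)" "y \<in> carrier (dirlim f)"
    from *(2,3) obtain i a b where "x = cl i a" "y = cl i b" by (rule carrierE2)
    with *(1) show "x = \<zero>\<^bsub>dirlim f\<^esub> \<or> y = \<zero>\<^bsub>dirlim f\<^esub>"
      by (simp add: cl_mult cl_eq_zero)
  qed
qed

end

section \<open>The transition maps\<close>

context
  fixes p :: "nat \<Rightarrow> nat"
  assumes p_pos: "\<And>i. p i > 0"
begin

lemma lookup_phi:
  fixes f :: "'k::idom laurent"
  shows "Poly_Mapping.lookup (phi p i f) (int (p i) * n) =
    Poly_Mapping.lookup f n * inverse (alpha (Suc i)) powi n"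
proof -
  have "Poly_Mapping.lookup (phi p i f) (int (p i) * n) =
      (\<Sum>k\<in>Poly_Mapping.keys f. if k = n then Poly_Mapping.lookup f n * inverse (alpha (Suc i)) powi n else 0)"
    unfolding phi_def lookup_sum
    by (rule sum.cong[OF refl]) (use p_pos[of i] in \<open>auto simp: lookup_single when_def\<close>)
  then show ?thesis by (simp add: in_keys_iff)
qed

text \<open>Distinct monomials have distinct nonzero images, because \<open>p i\<close> is positive
  and \<open>alpha (Suc i)\<close> is invertible; hence nothing cancels.\<close>

lemma keys_phi:
  fixes f :: "'k::idom laurent"
  shows "Poly_Mapping.keys (phi p i f) = (\<lambda>n. int (p i) * n) ` Poly_Mapping.keys f"
proof
  have "Poly_Mapping.keys (phi p i f) \<subseteq> (\<Union>n\<in>Poly_Mapping.keys f. Poly_Mapping.keys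
      (Poly_Mapping.single (int (p i) * n) (Poly_Mapping.lookup f n * inverse (alpha (Suc i)) powi n)))"
    unfolding phi_def by (rule Poly_Mapping.keys_sum)
  also have "\<dots> \<subseteq> (\<lambda>n. int (p i) * n) ` Poly_Mapping.keys f"
    by (auto split: if_splits)
  finally show "Poly_Mapping.keys (phi p i f) \<subseteq> (\<lambda>n. int (p i) * n) ` Poly_Mapping.keys f" .
  show "(\<lambda>n. int (p i) * n) ` Poly_Mapping.keys f \<subseteq> Poly_Mapping.keys (phi p i f)"
    by (auto simp: in_keys_iff lookup_phi alpha_nonzero)
qed

lemma phi_eq_0: "phi p i f = 0 \<Longrightarrow> f = (0 :: 'k::idom laurent)"
  using keys_phi[of i f] keys_nonempty[of f] by auto

lemma width_phi:
  assumes "f \<noteq> (0 :: 'k::idom laurent)"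
  shows "width (phi p i f) = int (p i) * width f"
proof -
  have mono: "mono (\<lambda>n. int (p i) * n)" by (intro monoI mult_left_mono) auto
  have "top_exp (phi p i f) = int (p i) * top_exp f" "bot_exp (phi p i f) = int (p i) * bot_exp f"
    unfolding top_exp_def bot_exp_def keys_phi
    using mono_Max_commute[OF mono, of "Poly_Mapping.keys f"]
      mono_Min_commute[OF mono, of "Poly_Mapping.keys f"] keys_nonempty[OF assms] by auto
  then show ?thesis by (simp add: width_def algebra_simps)
qed

interpretation injective_direct_system "phi p :: nat \<Rightarrow> 'k::idom laurent \<Rightarrow> 'k laurent"
  by unfold_locales (auto simp: phi_add phi_mult phi_one phi_eq_0)

lemma width_tr:
  assumes "n \<le> m" "f \<noteq> (0 :: 'k::idom laurent)"
  shows "width (tr n m f) = int (\<Prod>j=n..<m. p j) * width f"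
  using assms
  by (induction m rule: dec_induct)
     (auto simp: transition_refl transition_Suc width_phi tr_eq_0)

lemma tr_const: "n \<le> m \<Longrightarrow> tr n m (Poly_Mapping.single 0 c) = Poly_Mapping.single 0 c"
  by (induction m rule: dec_induct) (auto simp: transition_refl transition_Suc phi_const)

text \<open>The map out of stage \<open>i\<close> scales coefficients by powers of
  \<open>alpha (Suc i)\<close> only, so it affects the degree in that single indeterminate.\<close>

lemma vdeg_coeff_phi:
  fixes f :: "'k::idom laurent"
  assumes "k \<in> Poly_Mapping.keys (phi p i f)"
  shows "\<exists>n\<in>Poly_Mapping.keys f. k = int (p i) * n \<and> vdeg m (Poly_Mapping.lookup (phi p i f) k) =
    vdeg m (Poly_Mapping.lookup f n) - (if m = Suc i then n else 0)"
proof -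
  from assms obtain n where n: "n \<in> Poly_Mapping.keys f" "k = int (p i) * n"
    unfolding keys_phi by auto
  have "vdeg m (Poly_Mapping.lookup f n * inverse (alpha (Suc i)) powi n) =
      vdeg m (Poly_Mapping.lookup f n) - (if m = Suc i then n else 0)"
    using n(1) by (simp add: vdeg.v_mult vdeg.v_power_int vdeg.v_inverse vdeg_alpha alpha_nonzero in_keys_iff)
  with n show ?thesis by (auto simp: lookup_phi)
qed

text \<open>For large \<open>n\<close> the finitely many coefficients of \<open>f\<close> have
  degree zero in \<open>alpha (Suc n)\<close>, and the maps from stage \<open>i\<close> up to stage
  \<open>n\<close> introduce only indeterminates of index at most \<open>n\<close>.\<close>

lemma vdeg_coeff_stage:
  fixes f :: "'k::idom laurent"
  shows "\<exists>n\<ge>i. \<forall>k\<in>Poly_Mapping.keys (tr i n f). vdeg (Suc n) (Poly_Mapping.lookup (tr i n f) k) = 0"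
proof -
  have "\<forall>k. \<exists>N. \<forall>m\<ge>N. Poly_Mapping.lookup f k \<noteq> 0 \<longrightarrow> vdeg m (Poly_Mapping.lookup f k) = 0"
    using vdeg_eventually_zero by blast
  then obtain N where N: "\<And>k m. m \<ge> N k \<Longrightarrow> Poly_Mapping.lookup f k \<noteq> 0 \<Longrightarrow> vdeg m (Poly_Mapping.lookup f k) = 0"
    by metis
  define n where "n = max i (Max (N ` Poly_Mapping.keys f))"
  have n: "N k \<le> n" if "k \<in> Poly_Mapping.keys f" for k
    unfolding n_def using that by (intro max.coboundedI2 Max_ge) auto
  have "\<forall>k\<in>Poly_Mapping.keys (tr i j f). vdeg (Suc n) (Poly_Mapping.lookup (tr i j f) k) = 0"
    if "i \<le> j" "j \<le> n" for j
    using that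
  proof (induction j rule: dec_induct)
    case base
    then show ?case using N n by (auto simp: transition_refl in_keys_iff le_SucI)
  next
    case (step j)
    then show ?case
      using vdeg_coeff_phi[of _ j "tr i j f" "Suc n"] by (force simp: transition_Suc)
  qed
  then show ?thesis by (intro exI[of _ n]) (auto simp: n_def)
qed

text \<open>The map out of stage \<open>n\<close> gives the image of the \<open>l\<close>-th
  coefficient degree \<open>- l\<close> and moves its exponent to \<open>int (p n) * l\<close>. All
  points thus lie on one line through the origin, and later maps merely stretch it
  horizontally.\<close>

lemma straight_tr:
  fixes f :: "'k::idom laurent"
  assumes f: "f \<noteq> 0" "\<And>k. k \<in> Poly_Mapping.keys f \<Longrightarrow> vdeg (Suc n) (Poly_Mapping.lookup f k) = 0"
    and "n < m"
  shows "vdeg.straight (Suc n) (int (\<Prod>j=n..<m. p j)) (tr n m f)"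
proof (rule vdeg.straightI)
  show "tr n m f \<noteq> 0" using assms by (simp add: tr_eq_0)
  from \<open>n < m\<close> have "Suc n \<le> m" by simp
  \<comment> \<open>The induction starts at \<open>Suc n\<close>, because only the map out of stage
    \<open>n\<close> involves \<open>alpha (Suc n)\<close>.\<close>
  then show "int (\<Prod>j=n..<m. p j) * vdeg (Suc n) (Poly_Mapping.lookup (tr n m f) k) + k = 0"
    if "k \<in> Poly_Mapping.keys (tr n m f)" for k
    using that
  proof (induction m arbitrary: k rule: dec_induct)
    case base
    then have "k \<in> Poly_Mapping.keys (phi p n f)" by (simp add: transition_Suc transition_refl)
    from vdeg_coeff_phi[OF this, of "Suc n"] show ?case
      using f(2) by (auto simp: transition_Suc transition_refl)
  next
    case (step m)
    then have "k \<in> Poly_Mapping.keys (phi p m (tr n m f))" by (simp add: transition_Suc)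
    from vdeg_coeff_phi[OF this, of "Suc n"] step obtain l where
      l: "l \<in> Poly_Mapping.keys (tr n m f)" "k = int (p m) * l"
        "vdeg (Suc n) (Poly_Mapping.lookup (tr n (Suc m) f) k) = vdeg (Suc n) (Poly_Mapping.lookup (tr n m f) l)"
      by (auto simp: transition_Suc)
    have "int (\<Prod>j=n..<Suc m. p j) * vdeg (Suc n) (Poly_Mapping.lookup (tr n (Suc m) f) k) + k =
        int (p m) * (int (\<Prod>j=n..<m. p j) * vdeg (Suc n) (Poly_Mapping.lookup (tr n m f) l) + l)"
      unfolding l(3) using step(1) by (simp add: l(2) algebra_simps)
    also have "\<dots> = 0" using step.IH[OF l(1)] by simp
    finally show ?case .
  qed
qed

text \<open>Straightness passes from the image of \<open>f\<close> to its factors. This is the bound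
  that stops divisor chains in the limit.\<close>

lemma dvd_width_factor:
  fixes f :: "'k::idom laurent"
  assumes f: "f \<noteq> 0" "\<And>k. k \<in> Poly_Mapping.keys f \<Longrightarrow> vdeg (Suc n) (Poly_Mapping.lookup f k) = 0"
    and "n < m" and dvd: "a dvd tr n m f"
  shows "int (\<Prod>j=n..<m. p j) dvd width a"
proof -
  from dvd obtain b where b: "tr n m f = a * b" by auto
  moreover have "tr n m f \<noteq> 0" using assms by (simp add: tr_eq_0)
  ultimately have "a \<noteq> 0" "b \<noteq> 0" by auto
  then show ?thesis
    using vdeg.straight_dvd_width vdeg.straight_factor straight_tr[OF f \<open>n < m\<close>] b
    by (metis of_nat_0_le_iff)
qed

end

section \<open>Impossible towers of roots in the coefficient field\<close>

lemma single_zero_power: "Poly_Mapping.single 0 c ^ n = Poly_Mapping.single 0 (c ^ n)"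
  by (induction n) (auto simp: mult_single)

lemma diff_dvd_power_diff: "x - y dvd x ^ n - (y :: 'a::comm_ring_1) ^ n"
proof (induction n)
  case (Suc n)
  have "x ^ Suc n - y ^ Suc n = (x - y) * x ^ n + y * (x ^ n - y ^ n)"
    by (simp add: algebra_simps)
  then show ?case using Suc by simp
qed simp

text \<open>Choose \<open>N\<close> so large that \<open>\<tau> 0\<close> has degree zero in
  \<open>alpha (Suc N)\<close>. The recursion keeps this degree zero up to \<open>\<tau> N\<close>;
  the next step would make \<open>p N\<close> times an integer equal to 1.\<close>

lemma no_power_roots:
  fixes \<tau> :: "nat \<Rightarrow> 'k::idom ratfun"
  assumes p: "\<And>i. p i \<ge> 2" and nz: "\<And>i. \<tau> i \<noteq> 0"
    and eq: "\<And>i. \<tau> (Suc i) ^ p i = alpha (Suc i) * \<tau> i"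
  shows False
proof -
  have step: "int (p i) * vdeg m (\<tau> (Suc i)) = (if m = Suc i then 1 else 0) + vdeg m (\<tau> i)" for m i
    using arg_cong[OF eq[of i], of "vdeg m"] nz
    by (simp add: vdeg.v_power vdeg.v_mult alpha_nonzero vdeg_alpha)
  obtain N where "\<forall>m\<ge>N. vdeg m (\<tau> 0) = 0"
    using vdeg_eventually_zero[of "\<tau> 0"] nz by auto
  then have 0: "vdeg (Suc N) (\<tau> 0) = 0" by simp
  have "i \<le> N \<Longrightarrow> vdeg (Suc N) (\<tau> i) = 0" for i
  proof (induction i)
    case (Suc i)
    then have "int (p i) * vdeg (Suc N) (\<tau> (Suc i)) = 0" using step[of i "Suc N"] by simp
    then show ?case using p[of i] by auto
  qed (rule 0)
  then have "int (p N) * vdeg (Suc N) (\<tau> (Suc N)) = 1" using step[of N "Suc N"] by simp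
  then have "int (p N) dvd 1" by (metis dvd_triv_left)
  then show False using p[of N] by auto
qed

section \<open>Principal ideals of the limit ring\<close>

context
  fixes p :: "nat \<Rightarrow> nat"
  assumes p_ge_2: "\<And>i. p i \<ge> 2"
begin

lemma p_pos: "p i > 0"
  using p_ge_2[of i] by simp

interpretation injective_direct_system "phi p :: nat \<Rightarrow> 'k::idom laurent \<Rightarrow> 'k laurent"
  by unfold_locales (auto simp: phi_add phi_mult phi_one dest: phi_eq_0[OF p_pos])

text \<open>Among the divisors of a fixed nonzero element that lie in the ideal, one of least
  normalised width is a generator: its gcd with any other member is again such a divisor.\<close>

lemma principal_domain_Rk1: "principal_domain (Rk1 p :: (nat \<times> 'k::idom laurent) set ring)"
proof -
  let ?R = "dirlim (phi p) :: (nat \<times> 'k laurent) set ring"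
  interpret domain ?R by (rule domain_dirlim)
  have "\<exists>a\<in>carrier ?R. I = PIdl\<^bsub>?R\<^esub> a" if I: "ideal I ?R" for I
  proof (cases "I = {\<zero>\<^bsub>?R\<^esub>}")
    case True
    moreover have "PIdl\<^bsub>?R\<^esub> \<zero>\<^bsub>?R\<^esub> = {\<zero>\<^bsub>?R\<^esub>}"
      using zero_closed by (force simp: cgenideal_def)
    ultimately show ?thesis using zero_closed by blast
  next
    case False
    interpret I: ideal I ?R by (rule I)
    obtain x\<^sub>0 where x\<^sub>0: "x\<^sub>0 \<in> I" "x\<^sub>0 \<noteq> \<zero>\<^bsub>?R\<^esub>"
      using False I.zero_closed by auto
    obtain i f where f: "x\<^sub>0 = cl i f" using I.Icarr[OF x\<^sub>0(1)] by (rule carrierE)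
    \<comment> \<open>This stage meets the degree condition of \<open>dvd_width_factor\<close>, so
      \<open>t\<close> at stage \<open>n\<close> can serve as the unit of width.\<close>
    obtain n where n: "i \<le> n"
      "\<And>k. k \<in> Poly_Mapping.keys (tr i n f) \<Longrightarrow> vdeg (Suc n) (Poly_Mapping.lookup (tr i n f) k) = 0"
      using vdeg_coeff_stage[of p i f, OF p_pos] by blast
    define g where "g = tr i n f"
    have g: "x\<^sub>0 = cl n g" using f n by (simp add: g_def cl_tr)
    then have "g \<noteq> 0" using x\<^sub>0(2) by (simp add: cl_eq_zero)
    have dvd_width: "int (\<Prod>j=n..<m. p j) dvd width a" if "n < m" "a dvd tr n m g" for m a
      by (rule dvd_width_factor[OF p_pos \<open>g \<noteq> 0\<close> n(2)[folded g_def] that])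
    define P where "P m = (\<Prod>j=n..<m. p j)" for m
    have P_pos: "P m > 0" for m unfolding P_def by (rule prod_pos) (simp add: p_pos)
    text \<open>\<open>w\<close> is the width of \<open>h\<close> in units of \<open>t\<^sub>n\<close>, which is integral for divisors of \<open>x\<^sub>0\<close>.\<close>
    define D where "D h w \<longleftrightarrow> (\<exists>m a. n < m \<and> h = cl m a \<and> a dvd tr n m g \<and>
      width a = int (P m) * int w)" for h w
    have D: "\<exists>w. D (cl m a) w \<and> width a = int (P m) * int w"
      if a: "n < m" "a dvd tr n m g" for m a
    proof -
      have "tr n m g \<noteq> 0" using a(1) \<open>g \<noteq> 0\<close> by (simp add: tr_eq_0)
      then have "a \<noteq> 0" using a(2) by auto
      obtain w where w: "width a = int (P m) * w"
        using dvd_width[OF a] by (auto simp: P_def)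
      have "w \<ge> 0"
        using width_nonneg[OF \<open>a \<noteq> 0\<close>] P_pos[of m] by (simp add: w zero_le_mult_iff)
      with w have "width a = int (P m) * int (nat w)" by simp
      with a show ?thesis unfolding D_def by blast
    qed
    \<comment> \<open>The element \<open>x\<^sub>0\<close> itself qualifies, moved one stage onward
      because \<open>D\<close> asks for \<open>n < m\<close>.\<close>
    have "\<exists>w. \<exists>h\<in>I. D h w"
      using D[of "Suc n" "tr n (Suc n) g"] x\<^sub>0(1) g cl_tr[of n "Suc n" g] by auto
    define w where "w = (LEAST w. \<exists>h\<in>I. D h w)"
    have min: "w \<le> w'" if "h \<in> I" "D h w'" for w' h
      unfolding w_def using that by (intro Least_le) blast
    have "\<exists>h\<in>I. D h w"
      unfolding w_def by (rule LeastI_ex) fact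
    then obtain m a where a: "cl m a \<in> I" "n < m" "a dvd tr n m g" "width a = int (P m) * int w"
      unfolding D_def by blast
    have "tr n m g \<noteq> 0" using a \<open>g \<noteq> 0\<close> by (simp add: tr_eq_0)
    then have "a \<noteq> 0" using a by auto
    have "x \<in> PIdl\<^bsub>?R\<^esub> (cl m a)" if x: "x \<in> I" for x
    proof -
      obtain M b where b: "x = cl M b" "m \<le> M" using I.Icarr[OF x] by (rule carrierE)
      define a' where "a' = tr m M a"
      have a': "cl m a = cl M a'" "a' \<noteq> 0"
        using b \<open>a \<noteq> 0\<close> by (simp_all add: a'_def cl_tr tr_eq_0)
      obtain d u v where d: "d = u * a' + v * b" "d dvd a'" "d dvd b"
        using laurent_bezout by blast
      have "cl M d = cl M u \<otimes>\<^bsub>?R\<^esub> cl m a \<oplus>\<^bsub>?R\<^esub> cl M v \<otimes>\<^bsub>?R\<^esub> x"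
        by (simp add: d(1) a' b cl_mult cl_add)
      then have "cl M d \<in> I"
        using I.I_l_closed[OF a(1) cl_carrier] I.I_l_closed[OF x cl_carrier] I.a_closed by simp
      have "a' dvd tr n M g"
        unfolding a'_def using tr_dvd[OF b(2) a(3)] a(2) b(2) by (simp add: transition_trans)
      \<comment> \<open>The gcd \<open>d\<close> divides the image of \<open>g\<close> and
        represents a member of \<open>I\<close>, so it competes with \<open>a\<close> for
        minimality.\<close>
      with d(2) have "d dvd tr n M g" by (rule dvd_trans)
      with a(2) b(2) D[of M d] obtain w' where w': "D (cl M d) w'" "width d = int (P M) * int w'"
        by auto
      have "w \<le> w'" using min[OF \<open>cl M d \<in> I\<close> w'(1)] .
      have "P M = P m * (\<Prod>j=m..<M. p j)"
        unfolding P_def by (rule prod.atLeastLessThan_concat[symmetric]) (use a(2) b(2) in auto)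
      \<comment> \<open>Transition scales the width and the unit of measurement alike, so the
        normalised width remains \<open>w\<close>.\<close>
      then have "width a' = int (P M) * int w"
        unfolding a'_def width_tr[OF p_pos b(2) \<open>a \<noteq> 0\<close>] a(4) by simp
      obtain e where e: "a' = d * e" using d(2) by auto
      then have nz: "d \<noteq> 0" "e \<noteq> 0" using a'(2) by auto
      \<comment> \<open>The cofactor has no room for positive width, so it is a monomial;
        \<open>a'\<close> is then associated to \<open>d\<close> and divides
        \<open>b\<close>.\<close>
      have "width e = int (P M) * int w - int (P M) * int w'"
        using width_mult[OF nz] \<open>width a' = _\<close> w'(2) e by simp
      also have "\<dots> \<le> 0" using \<open>w \<le> w'\<close> by (simp add: mult_left_mono)
      finally have "width e = 0" using width_nonneg[OF nz(2)] by simp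
      then obtain k c where "c \<noteq> 0" "e = Poly_Mapping.single k c"
        using width_eq_0_imp_monomial[OF nz(2)] by blast
      then have "a' * Poly_Mapping.single (- k) (inverse c) = d"
        using monomial_unit[of c k] by (simp add: e mult.assoc)
      then have "a' dvd b" using d(3) by (metis dvd_trans dvd_triv_left)
      then obtain q where "b = a' * q" by auto
      then have "x = cl M q \<otimes>\<^bsub>?R\<^esub> cl m a" by (simp add: b a' cl_mult mult.commute)
      then show ?thesis unfolding cgenideal_def using cl_carrier by blast
    qed
    moreover have "PIdl\<^bsub>?R\<^esub> (cl m a) \<subseteq> I"
      using I.I_l_closed[OF a(1)] by (auto simp: cgenideal_def)
    ultimately show ?thesis using cl_carrier by blast
  qed
  then show ?thesis
    unfolding Rk1_def by unfold_locales
qed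

section \<open>Units and the failure of Euclidean division\<close>

lemma Units_Rk1:
  assumes "y \<in> Units (dirlim (phi p) :: (nat \<times> 'k::idom laurent) set ring)"
  shows "\<exists>m k c. c \<noteq> 0 \<and> y = cl m (Poly_Mapping.single k c)"
proof -
  let ?R = "dirlim (phi p) :: (nat \<times> 'k laurent) set ring"
  from assms obtain z where z: "y \<in> carrier ?R" "z \<in> carrier ?R" "y \<otimes>\<^bsub>?R\<^esub> z = \<one>\<^bsub>?R\<^esub>"
    by (auto simp: Units_def)
  from z(1,2) obtain i a b where "y = cl i a" "z = cl i b" by (rule carrierE2)
  moreover from this have "a * b = 1"
    using z(3) by (simp add: cl_mult cl_one[of i] cl_inject)
  ultimately show ?thesis using unit_imp_monomial by blast
qed

text \<open>Divisors of units are units. This is used contrapositively: a nonunit divides no nonzero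
  monomial.\<close>

lemma monomial_in_Units:
  assumes "a dvd Poly_Mapping.single k c" "c \<noteq> (0 :: 'k::idom ratfun)"
  shows "cl m a \<in> Units (dirlim (phi p))"
proof -
  from assms obtain b where "a * (b * Poly_Mapping.single (- k) (inverse c)) = 1"
    using monomial_unit[OF assms(2), of k] by (auto simp: mult.assoc)
  then obtain e where "a * e = 1" by blast
  then have "cl m a \<otimes>\<^bsub>dirlim (phi p)\<^esub> cl m e = \<one>\<^bsub>dirlim (phi p)\<^esub>"
    "cl m e \<otimes>\<^bsub>dirlim (phi p)\<^esub> cl m a = \<one>\<^bsub>dirlim (phi p)\<^esub>"
    by (simp_all add: cl_mult cl_one[of m] mult.commute)
  then show ?thesis
    unfolding Units_def using cl_carrier by blast
qed

text \<open>A nonzero nonunit of least norm is a universal side divisor: every element is congruent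
  to zero or a unit modulo it. Counting then makes all residues of the variables constant.\<close>

lemma not_euclidean_Rk1:
  assumes uncountable_k: "uncountable (UNIV :: 'k::idom set)"
  shows "\<not> euclidean_domain (Rk1 p :: (nat \<times> 'k laurent) set ring) \<phi>"
proof
  let ?R = "dirlim (phi p) :: (nat \<times> 'k laurent) set ring"
  let ?mono = "Poly_Mapping.single :: int \<Rightarrow> 'k ratfun \<Rightarrow> 'k laurent"
  let ?t = "?mono 1 1" and ?const = "?mono 0"
  assume "euclidean_domain (Rk1 p :: (nat \<times> 'k laurent) set ring) \<phi>"
  then interpret euclidean_domain ?R \<phi> by (simp add: Rk1_def)
  define nonunit where "nonunit x \<longleftrightarrow> x \<in> carrier ?R \<and> x \<noteq> \<zero>\<^bsub>?R\<^esub> \<and> x \<notin> Units ?R" for x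
  \<comment> \<open>A nonzero nonunit must exist before a minimal one can be chosen. Units are
    monomials of width zero, whereas this element has positive width at every stage.\<close>
  have "nonunit (cl 0 (?t + 1))"
  proof -
    have lookups: "Poly_Mapping.lookup (?t + 1) 0 = 1" "Poly_Mapping.lookup (?t + 1) 1 = 1"
      by (simp_all add: lookup_add lookup_single lookup_one when_def)
    then have "?t + 1 \<noteq> 0" by (metis lookup_zero zero_neq_one)
    moreover have False if unit: "cl 0 (?t + 1) \<in> Units ?R"
    proof -
      from unit obtain z where z: "z \<in> carrier ?R" "cl 0 (?t + 1) \<otimes>\<^bsub>?R\<^esub> z = \<one>\<^bsub>?R\<^esub>"
        by (auto simp: Units_def)
      obtain i b where b: "z = cl i b" using z(1) by (rule carrierE)
      have "cl i (tr 0 i (?t + 1) * b) = cl i 1"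
        using z(2) unfolding b cl_mult[symmetric] cl_tr[OF le0] cl_one[of i] .
      then have "tr 0 i (?t + 1) * b = 1" by (simp add: cl_inject)
      from unit_imp_monomial[OF this] obtain k c where "tr 0 i (?t + 1) = ?mono k c" "c \<noteq> 0" by blast
      then have "width (tr 0 i (?t + 1)) = 0"
        by (simp add: width_def top_exp_def bot_exp_def)
      then have "width (?t + 1) = 0"
        using \<open>?t + 1 \<noteq> 0\<close> p_pos by (simp add: width_tr[OF p_pos] less_not_refl2)
      moreover have "(0::int) \<in> Poly_Mapping.keys (?t + 1)" "1 \<in> Poly_Mapping.keys (?t + 1)"
        using lookups by (simp_all add: in_keys_iff)
      ultimately show False
        using le_top_exp[of 1 "?t + 1"] bot_exp_le[of 0 "?t + 1"] by (simp add: width_def)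
    qed
    ultimately show ?thesis
      unfolding nonunit_def by (auto simp: cl_carrier cl_eq_zero)
  qed
  then obtain \<pi> where \<pi>: "nonunit \<pi>" and min: "\<And>x. nonunit x \<Longrightarrow> \<phi> \<pi> \<le> \<phi> x"
    using ex_has_least_nat[of nonunit _ \<phi>] by blast
  obtain n \<omega> where \<omega>: "\<pi> = cl n \<omega>" using \<pi> unfolding nonunit_def by (metis carrierE)
  have not_dvd: "c = 0" if "n \<le> M" "tr n M \<omega> dvd ?mono k c" for M k c
  proof (rule ccontr)
    assume "c \<noteq> 0"
    from monomial_in_Units[OF that(2) this] show False
      using \<pi> \<omega> that(1) by (metis cl_tr nonunit_def)
  qed
  \<comment> \<open>A remainder is zero (\<open>c = 0\<close>) or a monomial. Splitting off the
    constant leaves an element of the limit determined by the countable data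
    \<open>(m, k)\<close>.\<close>
  have residue: "\<exists>m k c M. i \<le> M \<and> m \<le> M \<and> n \<le> M \<and>
      tr n M \<omega> dvd tr i M a - ?const c * tr m M (?mono k 1)" for i a
  proof -
    obtain q r where qr: "q \<in> carrier ?R" "r \<in> carrier ?R" "cl i a = \<pi> \<otimes>\<^bsub>?R\<^esub> q \<oplus>\<^bsub>?R\<^esub> r"
      "r = \<zero>\<^bsub>?R\<^esub> \<or> \<phi> r < \<phi> \<pi>"
    proof (cases "cl i a = \<zero>\<^bsub>?R\<^esub>")
      \<comment> \<open>The Euclidean property speaks of nonzero dividends; zero gets quotient and
        remainder zero.\<close>
      case True
      then show ?thesis using \<pi> by (intro that[of "\<zero>\<^bsub>?R\<^esub>" "\<zero>\<^bsub>?R\<^esub>"]) (auto simp: nonunit_def)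
    next
      case False
      then show ?thesis
        using euclidean_function[of "cl i a" \<pi>] \<pi> cl_carrier that unfolding nonunit_def by blast
    qed
    have "r = \<zero>\<^bsub>?R\<^esub> \<or> r \<in> Units ?R"
      using qr(2,4) min[of r] unfolding nonunit_def by linarith
    then obtain m k c where r: "r = cl m (?mono k c)"
    proof
      assume "r = \<zero>\<^bsub>?R\<^esub>"
      then show ?thesis using that[of 0 0 0] by (simp add: cl_zero[of 0])
    qed (use Units_Rk1 that in blast)
    obtain M b where b: "q = cl M b" "max i (max m n) \<le> M"
      using qr(1) by (rule carrierE)
    have "cl M (tr i M a) = cl M (tr n M \<omega> * b + tr m M (?mono k c))"
      using qr(3) b by (simp add: r \<omega> cl_tr flip: cl_add cl_mult)
    then have "tr i M a = tr n M \<omega> * b + tr m M (?mono k c)"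
      by (simp add: cl_inject)
    moreover have "tr m M (?mono k c) = ?const c * tr m M (?mono k 1)"
    proof -
      have "?mono k c = ?const c * ?mono k 1" by (simp add: mult_single)
      then show ?thesis using b(2) by (simp add: tr_mult tr_const[OF p_pos])
    qed
    ultimately have "tr n M \<omega> dvd tr i M a - ?const c * tr m M (?mono k 1)" by simp
    with b(2) show ?thesis by (meson max.bounded_iff)
  qed
  have "\<exists>\<tau> M. i \<le> M \<and> n \<le> M \<and> tr n M \<omega> dvd tr i M ?t - ?const \<tau>" for i
  proof -
    \<comment> \<open>The constants from the ground field supply uncountably many elements
      \<open>?t + ?const (emb c)\<close>.\<close>
    define emb :: "'k \<Rightarrow> 'k ratfun" where "emb c = Fract (Poly_Mapping.single 0 c) 1" for c
    have emb: "emb c = emb d \<longleftrightarrow> c = d" for c d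
      by (simp add: emb_def eq_fract inj_eq[OF inj_single])
    have "\<forall>c. \<exists>m k \<kappa> M. i \<le> M \<and> m \<le> M \<and> n \<le> M \<and>
        tr n M \<omega> dvd tr i M (?t + ?const (emb c)) - ?const \<kappa> * tr m M (?mono k 1)"
      using residue by blast
    then obtain m k \<kappa> M where res: "i \<le> M c" "m c \<le> M c" "n \<le> M c"
      "tr n (M c) \<omega> dvd tr i (M c) (?t + ?const (emb c)) - ?const (\<kappa> c) * tr (m c) (M c) (?mono (k c) 1)" for c
      by metis
    \<comment> \<open>Pigeonhole: two different constants share the same unit monomial in their
      remainders.\<close>
    have "\<not> inj (\<lambda>c. (m c, k c))"
      using uncountable_k by (meson countableI_type countable_image_inj_on)
    then obtain c d where cd: "c \<noteq> d" "m c = m d" "k c = k d" by (auto simp: inj_def)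
    define L where "L = max (M c) (M d)"
    have L: "i \<le> L" "m d \<le> L" "n \<le> L" "M c \<le> L" "M d \<le> L"
      using res[of c] res[of d] by (auto simp: L_def)
    define T U W where "T = tr i L ?t" and "U = tr (m d) L (?mono (k d) 1)" and "W = tr n L \<omega>"
    have TU: "W dvd T + ?const (emb e) - ?const (\<kappa> e) * U" if "e = c \<or> e = d" for e
    proof -
      have "m e = m d" "k e = k d" "M e \<le> L" using that cd L by auto
      then show ?thesis
        using tr_dvd[OF \<open>M e \<le> L\<close> res(4)[of e]] res(1-3)[of e] L
        by (simp add: T_def U_def W_def tr_diff tr_add tr_mult tr_const[OF p_pos] transition_trans)
    qed
    \<comment> \<open>Otherwise subtracting the two congruences would leave a nonzero constant
      divisible by \<open>W\<close>.\<close>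
    have "\<kappa> c \<noteq> \<kappa> d"
    proof
      assume "\<kappa> c = \<kappa> d"
      then have "W dvd ?const (emb c - emb d)"
        using dvd_diff[OF TU[of c] TU[of d]] by (simp add: single_diff)
      from not_dvd[OF L(3) this[unfolded W_def]] show False using emb cd by simp
    qed
    \<comment> \<open>Eliminating \<open>U\<close> from the two congruences gives a constant
      multiple of \<open>T\<close> congruent to a constant; \<open>\<delta>\<close> inverts that
      multiple and \<open>\<tau>\<close> is the resulting residue of \<open>T\<close>.\<close>
    define \<delta> where "\<delta> = inverse (\<kappa> d - \<kappa> c)"
    define \<tau> where "\<tau> = \<delta> * (\<kappa> c * emb d - \<kappa> d * emb c)"
    have eliminate: "D * (K' * (T + C - K * U) - K * (T + C' - K' * U)) =
        D * (K' - K) * T - D * (K * C' - K' * C)" for C C' D K K' :: "'k laurent"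
      by (simp add: algebra_simps)
    have "W dvd ?const \<delta> * (?const (\<kappa> d) * (T + ?const (emb c) - ?const (\<kappa> c) * U) -
        ?const (\<kappa> c) * (T + ?const (emb d) - ?const (\<kappa> d) * U))"
      by (intro dvd_mult dvd_diff TU) auto
    also have "\<dots> = ?const \<delta> * (?const (\<kappa> d) - ?const (\<kappa> c)) * T -
        ?const \<delta> * (?const (\<kappa> c) * ?const (emb d) - ?const (\<kappa> d) * ?const (emb c))"
      by (rule eliminate)
    also have "\<dots> = ?const (\<delta> * (\<kappa> d - \<kappa> c)) * T - ?const \<tau>"
      by (simp add: \<tau>_def mult_single flip: single_diff)
    also have "\<dots> = T - ?const \<tau>"
      using \<open>\<kappa> c \<noteq> \<kappa> d\<close> by (simp add: \<delta>_def)
    finally show ?thesis using L unfolding T_def W_def by blast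
  qed
  then obtain \<tau> M where M: "i \<le> M i" "n \<le> M i" "tr n (M i) \<omega> dvd tr i (M i) ?t - ?const (\<tau> i)" for i
    by metis
  have lift: "tr n L \<omega> dvd tr i L ?t - ?const (\<tau> i)" if "M i \<le> L" for i L
    using tr_dvd[OF that M(3)[of i]] M(1,2)[of i] that
    by (simp add: tr_diff tr_const[OF p_pos] transition_trans)
  show False
  proof (rule no_power_roots[OF p_ge_2])
    fix i
    \<comment> \<open>A zero residue would make \<open>\<pi>\<close> divide the unit
      \<open>?t\<close> of stage \<open>i\<close>.\<close>
    show "\<tau> i \<noteq> 0"
    proof
      assume "\<tau> i = 0"
      then have "tr n (M i) \<omega> dvd tr i (M i) ?t" using M(3)[of i] by simp
      also have "\<dots> dvd tr i (M i) 1"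
        by (rule tr_dvd[OF M(1)]) (use monomial_unit[of 1 1] in \<open>metis dvd_triv_left one_neq_zero\<close>)
      also have "\<dots> = ?const 1" by (simp add: tr_one M(1))
      finally show False using not_dvd[OF M(2)] by fastforce
    qed
    define L where "L = max (M i) (M (Suc i))"
    have L: "i \<le> L" "Suc i \<le> L" "n \<le> L" "M i \<le> L" "M (Suc i) \<le> L"
      using M(1,2)[of i] M(1)[of "Suc i"] by (auto simp: L_def)
    \<comment> \<open>The relation defining \<open>phi p i\<close> on \<open>?t\<close> is now
      reduced modulo \<open>\<pi>\<close> at the common stage \<open>L\<close>, replacing both
      variables by their residues.\<close>
    define \<beta> where "\<beta> = inverse (alpha (Suc i) :: 'k ratfun)"
    define T where "T = tr (Suc i) L ?t"
    have "?t ^ q = ?mono (int q) 1" for q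
      by (induction q) (simp_all add: mult_single add.commute)
    then have "phi p i ?t = ?const \<beta> * ?t ^ p i" by (simp add: phi_t \<beta>_def mult_single)
    moreover have "tr i L ?t = tr (Suc i) L (phi p i ?t)"
      using transition_trans[of i "Suc i" L "phi p" ?t] L by (simp add: transition_Suc transition_refl)
    ultimately have "tr i L ?t = ?const \<beta> * T ^ p i"
      using L by (simp add: T_def tr_mult tr_power tr_const[OF p_pos])
    with lift[OF L(4)] have 1: "tr n L \<omega> dvd ?const \<beta> * T ^ p i - ?const (\<tau> i)" by simp
    have "tr n L \<omega> dvd T ^ p i - ?const (\<tau> (Suc i)) ^ p i"
      using lift[OF L(5)] diff_dvd_power_diff unfolding T_def by (rule dvd_trans)
    then have "tr n L \<omega> dvd ?const \<beta> * (T ^ p i - ?const (\<tau> (Suc i)) ^ p i)" by simp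
    from dvd_diff[OF 1 this] have "tr n L \<omega> dvd ?const \<beta> * ?const (\<tau> (Suc i)) ^ p i - ?const (\<tau> i)"
      by (simp add: right_diff_distrib)
    then have "tr n L \<omega> dvd ?const (\<beta> * \<tau> (Suc i) ^ p i - \<tau> i)"
      by (simp add: single_zero_power mult_single single_diff)
    \<comment> \<open>A constant divisible by \<open>\<pi>\<close> vanishes, so the congruence is an
      equation in the coefficient field.\<close>
    from not_dvd[OF L(3) this] have "\<tau> i = \<beta> * \<tau> (Suc i) ^ p i" by simp
    then show "\<tau> (Suc i) ^ p i = alpha (Suc i) * \<tau> i"
      by (simp add: \<beta>_def alpha_nonzero flip: mult.assoc)
  qed
qed

end

theorem proposition4p10:
  fixes p :: "nat \<Rightarrow> nat"
    and R :: "(nat \<times> 'k::field_char_0 laurent) set ring"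
  assumes uncountable_k: "uncountable (UNIV :: 'k set)"
    and prime_p: "\<And>i. prime (p i)"
    and union_p: "(UNIV :: rat set) =
      (\<Union>i. range (\<lambda>m :: int. of_int m / of_nat (\<Prod>j\<le>i. p j)))"
    and R_def: "R = Rk1 p"
  shows "principal_domain R \<and> \<not> (\<exists>\<phi>. euclidean_domain R \<phi>)"
proof -
  have p_ge_2: "p i \<ge> 2" for i
    using prime_p by (rule prime_ge_2_nat)
  from principal_domain_Rk1[of p] not_euclidean_Rk1[of p, OF _ uncountable_k] p_ge_2 show ?thesis
    unfolding R_def by blast
qed

end
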